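(* Let $E\subset\mathbb{R}$ be a nonempty compact perfect nowhere-dense set such that $E\cap(\overline{\mathbb{Q}}_{\mathbb{R}}\cup\mathscr{L})=\varnothing$. For every neighborhood $\mathcal{U}$ of the identity in the compact-open $C^\infty$ topology, there exists an orientation-preserving $C^\infty$ diffeomorphism $f:\mathbb{R}\to\mathbb{R}$ with the following properties: (i) $f\in\mathcal{U}$ and $\operatorname{NA}(f)=E$; (ii) for every connected component $I$ of $\mathbb{R}\setminus E$, there exists $R_I\in\mathbb{Q}(z)$ such that $f|_I=R_I|_I$, the finite poles of $R_I$ (in $\mathbb{C}$) are exactly $i$ and $-i$, and $R_I(\infty)=\infty$ on the Riemann sphere; (iii) $f$ is transcendental over $\mathbb{R}(x)$; (iv) for every real number field $K\subset\mathbb{R}$, every $n\geq1$, and every $m\geq0$, $D^m(f^{\circ n})(K)\subseteq K$; (v) for every $n\geq1$ and every $m\geq0$, $D^m(f^{\circ n})(\mathscr{L})\subseteq\mathscr{L}$. Moreover, one may choose a sequence of such diffeomorphisms converging to the identity in $C^\infty(\mathbb{R})$; that is, there is a sequence $(f_\nu)$ of orientation-preserving $C^\infty$ diffeomorphisms of $\mathbb{R}$, each satisfying $\operatorname{NA}(f_\nu)=E$ and (ii)–(v), with $f_\nu\to\mathrm{id}$ in $C^\infty(\mathbb{R})$.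
   Context: $\overline{\mathbb{Q}}_{\mathbb{R}}=\overline{\mathbb{Q}}\cap\mathbb{R}$ is the set of real algebraic numbers. A real number $\xi$ is a Liouville number if for every integer $N\geq1$ there are integers $p$ and $q\geq2$ with $0<|\xi-p/q|<q^{-N}$; $\mathscr{L}$ denotes the set of Liouville numbers. A real number field is a finite extension $K/\mathbb{Q}$ contained in $\mathbb{R}$. $D^m u$ is the $m$th derivative of $u$ ($D^0u=u$), $f^{\circ n}$ is the $n$th iterate of $f$, and $u(A)=\{u(x):x\in A\}$. $\operatorname{NA}(u)$ is the set of points at which $u$ is not real-analytic. A function $u:J\to\mathbb{R}$ is algebraic over $\mathbb{R}(x)$ if there is a nonzero $P\in\mathbb{R}[X,Y]$ with $P(x,u(x))=0$ for all $x\in J$; otherwise it is transcendental over $\mathbb{R}(x)$. The compact-open $C^\infty$ topology on $C^\infty(\mathbb{R})$ is generated by the seminorms $p_{A,r}(u)=\max_{0\le j\le r}\sup_{|x|\le A}|u^{(j)}(x)|$, $A,r\in\mathbb{N}$. A perfect set is a closed set without isolated points. *)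

theory Defs
  imports
    "HOL-Complex_Analysis.Complex_Analysis"
    "HOL-Computational_Algebra.Polynomial_Factorial"
    "HOL-Computational_Algebra.Field_as_Ring"
begin

subsection \<open>Subsets of the real line\<close>

definition perfect_set :: "'a::topological_space set \<Rightarrow> bool" where
  "perfect_set S \<longleftrightarrow> closed S \<and> (\<forall>x. \<not> x isolated_in S)"

definition liouville_numbers :: "real set" where
  "liouville_numbers =
     {\<xi>. \<forall>N::nat. N \<ge> 1 \<longrightarrow>
        (\<exists>p q :: int. q \<ge> 2 \<and> 0 < \<bar>\<xi> - of_int p / of_int q\<bar>
           \<and> \<bar>\<xi> - of_int p / of_int q\<bar> < 1 / of_int q ^ N)}"

global_interpretation rat_real: vector_space "\<lambda>(q::rat) (x::real). of_rat q * x"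
  by standard (simp_all add: algebra_simps of_rat_add of_rat_mult)

definition real_number_field :: "real set \<Rightarrow> bool" where
  "real_number_field K \<longleftrightarrow>
     0 \<in> K \<and> 1 \<in> K \<and>
     (\<forall>x\<in>K. \<forall>y\<in>K. x + y \<in> K \<and> x * y \<in> K) \<and>
     (\<forall>x\<in>K. - x \<in> K \<and> inverse x \<in> K) \<and>
     (\<exists>B. finite B \<and> K = rat_real.span B)"


subsection \<open>Smooth functions and the compact-open smooth topology\<close>

definition smooth :: "(real \<Rightarrow> real) \<Rightarrow> bool" where
  "smooth u \<longleftrightarrow> (\<forall>m. (deriv ^^ m) u differentiable_on UNIV)"

definition smooth_seminorm :: "nat \<Rightarrow> nat \<Rightarrow> (real \<Rightarrow> real) \<Rightarrow> real" where
  "smooth_seminorm A r u =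
     (MAX j\<in>{0..r}. SUP x\<in>{- real A..real A}. \<bar>(deriv ^^ j) u x\<bar>)"

definition smooth_topology :: "(real \<Rightarrow> real) topology" where
  "smooth_topology = topology_generated_by
     {{v. smooth v \<and> smooth_seminorm A r (\<lambda>x. v x - u x) < \<epsilon>} | u A r \<epsilon>. smooth u \<and> \<epsilon> > 0}"

lemma topspace_smooth_topology: "topspace smooth_topology = {u. smooth u}"
proof -
  have "deriv (\<lambda>_::real. 0::real) = (\<lambda>_. 0)"
    by (simp add: fun_eq_iff)
  hence "(deriv ^^ j) (\<lambda>_::real. 0::real) = (\<lambda>_. 0)" for j
    by (induction j) (simp_all del: funpow.simps add: funpow_Suc_right)
  hence zero: "smooth_seminorm 0 0 (\<lambda>x. 0) = 0"
    by (simp add: smooth_seminorm_def)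
  let ?\<B> = "{{v. smooth v \<and> smooth_seminorm A r (\<lambda>x. v x - u x) < \<epsilon>} | u A r \<epsilon>. smooth u \<and> \<epsilon> > 0}"
  have "u \<in> \<Union>?\<B>" if u: "smooth u" for u
  proof
    show "u \<in> {v. smooth v \<and> smooth_seminorm 0 0 (\<lambda>x. v x - u x) < 1}"
      using u zero by simp
    show "{v. smooth v \<and> smooth_seminorm 0 0 (\<lambda>x. v x - u x) < 1} \<in> ?\<B>"
      using u zero_less_one by blast
  qed
  hence "\<Union>?\<B> = {u. smooth u}"
    by blast
  thus ?thesis
    by (simp only: smooth_topology_def topology_generated_by_topspace)
qed

definition nbhd_in :: "'a topology \<Rightarrow> 'a \<Rightarrow> 'a set \<Rightarrow> bool" where
  "nbhd_in X x U \<longleftrightarrow> U \<subseteq> topspace X \<and> (\<exists>V. openin X V \<and> x \<in> V \<and> V \<subseteq> U)"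

definition orientation_preserving_diffeo :: "(real \<Rightarrow> real) \<Rightarrow> bool" where
  "orientation_preserving_diffeo f \<longleftrightarrow>
     bij f \<and> smooth f \<and> smooth (inv f) \<and> (\<forall>x. deriv f x > 0)"


subsection \<open>Analyticity, rational functions and transcendence\<close>

definition real_analytic_at :: "(real \<Rightarrow> real) \<Rightarrow> real \<Rightarrow> bool" where
  "real_analytic_at u x \<longleftrightarrow> (\<exists>F. (\<lambda>h. u (x + h)) has_fps_expansion F)"

definition NA :: "(real \<Rightarrow> real) \<Rightarrow> real set" where
  "NA u = {x. \<not> real_analytic_at u x}"

text \<open>
  Evaluation of a rational function over the rationals in a field of characteristic 0. Since
  \<^const>\<open>quot_of_fract\<close> yields a representation in lowest terms, the value is the correct
  one at every point that is not a pole; at a pole it is 0 by the convention for division.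
\<close>

definition ratfun_eval :: "rat poly fract \<Rightarrow> 'a::field_char_0 \<Rightarrow> 'a" where
  "ratfun_eval R z =
     poly (map_poly of_rat (fst (quot_of_fract R))) z /
     poly (map_poly of_rat (snd (quot_of_fract R))) z"

text \<open>
  A bivariate polynomial is a polynomial in \<open>Y\<close> with coefficients in \<open>\<real>[X]\<close>, so that
  \<open>P(x,y)\<close> is \<open>poly (poly P [:y:]) x\<close>.
\<close>

definition algebraic_over_ratfuns :: "real set \<Rightarrow> (real \<Rightarrow> real) \<Rightarrow> bool" where
  "algebraic_over_ratfuns J u \<longleftrightarrow>
     (\<exists>P :: real poly poly. P \<noteq> 0 \<and> (\<forall>x\<in>J. poly (poly P [:u x:]) x = 0))"


subsection \<open>The diffeomorphisms to be constructed\<close>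

definition rational_off_diffeo :: "real set \<Rightarrow> (real \<Rightarrow> real) \<Rightarrow> bool" where
  "rational_off_diffeo E f \<longleftrightarrow>
     orientation_preserving_diffeo f \<and>
     NA f = E \<and>
     (\<forall>I \<in> components (- E). \<exists>R :: rat poly fract.
        (\<forall>x\<in>I. f x = ratfun_eval R x) \<and>
        {z::complex. is_pole (ratfun_eval R) z} = {\<i>, - \<i>} \<and>
        filterlim (ratfun_eval R :: complex \<Rightarrow> complex) at_infinity at_infinity) \<and>
     \<not> algebraic_over_ratfuns UNIV f \<and>
     (\<forall>K n m. real_number_field K \<and> n \<ge> 1 \<longrightarrow> (deriv ^^ m) (f ^^ n) ` K \<subseteq> K) \<and>
     (\<forall>n m. n \<ge> 1 \<longrightarrow> (deriv ^^ m) (f ^^ n) ` liouville_numbers \<subseteq> liouville_numbers)"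

end

(*
Let f(x) = x + r/(1 + x^2) + w(x) with a small rational r > 0 and a small smooth function w that
vanishes outside the convex hull of E and on every bounded gap of E coincides with a polynomial over
the rationals, different gaps carrying different polynomials. Such a w is a limit of functions
w_(n+1) = w_n + psi * (p - w_n): the bump function psi is 1 on the n-th gap and vanishes on the gaps
treated before (closures of different gaps are disjoint because E is perfect), and p is a rational
polynomial close to w_n in C^n near that gap.

Every neighbourhood of a point of E contains two gaps, on which f is given by different rational
functions, so f is not analytic there; and only finitely many rational functions R satisfy a given
algebraic relation P(x, R(x)) = 0. Number fields and the set of Liouville numbers avoid E and are
mapped into themselves, so near their points the iterates of f are compositions of rational
functions. These compositions tend to infinity at the imaginary unit, hence are not polynomials and
have no constant derivative of any order; Maillet's theorem then applies to all their derivatives.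
*)
theory Submission
  imports Defs
begin


subsection \<open>Calculus of smooth functions\<close>

text \<open>The shape of f is dictated by the iterates. The term r/(1 + x^2) gives every branch its
  poles at i and -i, and a polynomial summand neither adds nor removes finite poles, so only
  polynomials remain to be varied. On each gap x + w is a nonconstant polynomial, because |w'| is at
  most 1/4; hence every branch fixes infinity. Along an orbit the innermost branch sends i to
  infinity and all later ones, however they change from point to point, keep it there. This
  invariant excludes constant derivatives, the only case in which Maillet's argument fails.

  For w, the n-th correction and its derivatives of order up to n + k are at most eta/2^(n+1). Every
  order is thus controlled from some stage on, which makes the limit smooth, while the orders up to
  k are controlled from the start and sum to at most eta, which puts f near the identity. A rational
  constant added to p costs little and separates p from the polynomials of all earlier gaps.

  Since |1/(1 + x^2)| and its derivative are at most 1, the bounds 1/4 on r and w' leave f' at least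
  1/2.\<close>

definition ntimes_diff :: "nat \<Rightarrow> (real \<Rightarrow> real) \<Rightarrow> bool" where
  "ntimes_diff n u \<longleftrightarrow> (\<forall>m<n. (deriv ^^ m) u differentiable_on UNIV)"

lemma smooth_iff_ntimes_diff: "smooth u \<longleftrightarrow> (\<forall>n. ntimes_diff n u)"
  unfolding smooth_def ntimes_diff_def by auto

lemma ntimes_diff_0 [simp]: "ntimes_diff 0 u"
  by (simp add: ntimes_diff_def)

lemma funpow_deriv_Suc: "(deriv ^^ Suc m) u = (deriv ^^ m) (deriv u)"
  by (simp add: funpow_Suc_right del: funpow.simps)

lemma ntimes_diff_Suc:
  "ntimes_diff (Suc n) u \<longleftrightarrow> u differentiable_on UNIV \<and> ntimes_diff n (deriv u)"
  unfolding ntimes_diff_def by (auto simp: less_Suc_eq_0_disj funpow_deriv_Suc simp del: funpow.simps(2))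

lemma ntimes_diff_SucI:
  assumes "\<And>x. (u has_real_derivative u' x) (at x)" "ntimes_diff n u'"
  shows "ntimes_diff (Suc n) u"
proof -
  have "deriv u = u'" using assms(1) by (auto intro: DERIV_imp_deriv)
  moreover have "u differentiable_on UNIV"
    unfolding differentiable_on_def differentiable_def using assms(1) has_field_derivative_def by blast
  ultimately show ?thesis using assms(2) by (simp add: ntimes_diff_Suc)
qed

lemma ntimes_diff_SucD:
  assumes "ntimes_diff (Suc n) u"
  shows "(u has_real_derivative deriv u x) (at x)" "ntimes_diff n (deriv u)"
  using assms unfolding ntimes_diff_Suc differentiable_on_def
  by (auto simp: DERIV_deriv_iff_real_differentiable)

lemma ntimes_diff_weaken: "ntimes_diff (Suc n) u \<Longrightarrow> ntimes_diff n u"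
  by (auto simp: ntimes_diff_def)

lemma ntimes_diff_add:
  "ntimes_diff n u \<Longrightarrow> ntimes_diff n v \<Longrightarrow> ntimes_diff n (\<lambda>x. u x + v x)"
proof (induction n arbitrary: u v)
  case (Suc n)
  show ?case
    by (rule ntimes_diff_SucI[where u' = "\<lambda>x. deriv u x + deriv v x"])
      (intro DERIV_add ntimes_diff_SucD[OF Suc.prems(1)]
        ntimes_diff_SucD[OF Suc.prems(2)] Suc.IH)+
qed simp

text \<open>The derivative of a product contains the undifferentiated factors, which
  \<open>ntimes_diff_weaken\<close> supplies at the lower order. This is why a finite order is
  introduced: \<open>smooth\<close> alone offers nothing to induct on.\<close>

lemma ntimes_diff_mult:
  "ntimes_diff n u \<Longrightarrow> ntimes_diff n v \<Longrightarrow> ntimes_diff n (\<lambda>x. u x * v x)"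
proof (induction n arbitrary: u v)
  case (Suc n)
  note D = ntimes_diff_SucD[OF Suc.prems(1)] ntimes_diff_SucD[OF Suc.prems(2)]
  show ?case
    by (rule ntimes_diff_SucI[where u' = "\<lambda>x. deriv u x * v x + deriv v x * u x"])
      (intro DERIV_mult D ntimes_diff_add Suc.IH ntimes_diff_weaken[OF Suc.prems(1)]
        ntimes_diff_weaken[OF Suc.prems(2)])+
qed simp

lemma ntimes_diff_compose:
  "ntimes_diff n u \<Longrightarrow> ntimes_diff n v \<Longrightarrow> ntimes_diff n (u \<circ> v)"
proof (induction n arbitrary: u v)
  case (Suc n)
  note u = ntimes_diff_SucD[OF Suc.prems(1)]
  note v = ntimes_diff_SucD[OF Suc.prems(2)]
  have "ntimes_diff n (\<lambda>x. (deriv u \<circ> v) x * deriv v x)"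
    by (intro ntimes_diff_mult Suc.IH u v ntimes_diff_weaken[OF Suc.prems(2)])
  moreover have "((u \<circ> v) has_real_derivative (deriv u \<circ> v) x * deriv v x) (at x)" for x
    using DERIV_chain[OF u(1) v(1)] by simp
  ultimately show ?case by (rule ntimes_diff_SucI[rotated])
qed simp

lemma ntimes_diff_const: "ntimes_diff n (\<lambda>_. c)"
  by (induction n arbitrary: c)
    (auto intro!: ntimes_diff_SucI[where u' = "\<lambda>_. 0"] derivative_eq_intros)

lemma ntimes_diff_inverse:
  "ntimes_diff n u \<Longrightarrow> (\<And>x. u x \<noteq> 0) \<Longrightarrow> ntimes_diff n (\<lambda>x. inverse (u x))"
proof (induction n arbitrary: u)
  case (Suc n)
  note D = ntimes_diff_SucD[OF Suc.prems(1)]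
  have w: "ntimes_diff n (\<lambda>x. inverse (u x))"
    by (intro Suc.IH ntimes_diff_weaken[OF Suc.prems(1)] Suc.prems(2))
  show ?case
  proof (rule ntimes_diff_SucI)
    show "((\<lambda>x. inverse (u x)) has_real_derivative
        ((- 1) * deriv u x) * (inverse (u x) * inverse (u x))) (at x)" for x
      using DERIV_inverse_fun[OF D(1) Suc.prems(2), of x] by (simp add: mult_ac)
    show "ntimes_diff n (\<lambda>x. ((- 1) * deriv u x) * (inverse (u x) * inverse (u x)))"
      by (intro ntimes_diff_mult ntimes_diff_const w D)
  qed
qed simp

lemma smooth_add: "smooth u \<Longrightarrow> smooth v \<Longrightarrow> smooth (\<lambda>x. u x + v x)"
  by (simp add: smooth_iff_ntimes_diff ntimes_diff_add)

lemma smooth_mult: "smooth u \<Longrightarrow> smooth v \<Longrightarrow> smooth (\<lambda>x. u x * v x)"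
  by (simp add: smooth_iff_ntimes_diff ntimes_diff_mult)

lemma smooth_compose: "smooth u \<Longrightarrow> smooth v \<Longrightarrow> smooth (\<lambda>x. u (v x))"
  using ntimes_diff_compose[of _ u v] by (simp add: smooth_iff_ntimes_diff comp_def)

lemma smooth_const: "smooth (\<lambda>_. c)"
  by (simp add: smooth_iff_ntimes_diff ntimes_diff_const)

lemma smooth_inverse: "smooth u \<Longrightarrow> (\<And>x. u x \<noteq> 0) \<Longrightarrow> smooth (\<lambda>x. inverse (u x))"
  by (simp add: smooth_iff_ntimes_diff ntimes_diff_inverse)

lemma smooth_cmult: "smooth u \<Longrightarrow> smooth (\<lambda>x. c * u x)"
  by (rule smooth_mult[OF smooth_const])

lemma smooth_diff: "smooth u \<Longrightarrow> smooth v \<Longrightarrow> smooth (\<lambda>x. u x - v x)"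
  using smooth_add[of u "\<lambda>x. (-1) * v x"] smooth_cmult[of v "-1"] by simp

lemma smooth_DERIV: "smooth u \<Longrightarrow> (u has_real_derivative deriv u x) (at x)"
  by (meson ntimes_diff_SucD(1) smooth_iff_ntimes_diff)

lemma smooth_deriv: "smooth u \<Longrightarrow> smooth (deriv u)"
  by (meson ntimes_diff_SucD(2) smooth_iff_ntimes_diff)

lemma smooth_higher_deriv: "smooth u \<Longrightarrow> smooth ((deriv ^^ m) u)"
  by (induction m) (auto intro: smooth_deriv)

lemma smoothI:
  assumes "\<And>x. (u has_real_derivative u' x) (at x)" "smooth u'"
  shows "smooth u"
  using assms ntimes_diff_SucI ntimes_diff_weaken unfolding smooth_iff_ntimes_diff by blast

lemma smooth_continuous_on: "smooth u \<Longrightarrow> continuous_on S u"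
  by (meson DERIV_continuous continuous_at_imp_continuous_on smooth_DERIV)

lemma smooth_ident: "smooth (\<lambda>x. x)"
  by (rule smoothI[where u' = "\<lambda>_. 1"]) (auto intro!: smooth_const)

lemma smooth_poly: "smooth (poly p)"
  by (induction p) (simp_all add: smooth_const smooth_add smooth_mult smooth_ident)

lemma smooth_higher_deriv_add:
  "smooth u \<Longrightarrow> smooth v \<Longrightarrow>
    (deriv ^^ j) (\<lambda>x. u x + v x) = (\<lambda>x. (deriv ^^ j) u x + (deriv ^^ j) v x)"
proof (induction j arbitrary: u v)
  case (Suc j)
  have "deriv (\<lambda>x. u x + v x) = (\<lambda>x. deriv u x + deriv v x)"
    by (rule ext, rule DERIV_imp_deriv) (intro DERIV_add smooth_DERIV Suc.prems)
  then show ?case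
    using Suc.IH[of "deriv u" "deriv v"] Suc.prems
    by (simp add: funpow_deriv_Suc smooth_deriv del: funpow.simps)
qed simp

lemma smooth_higher_deriv_cmult:
  "smooth u \<Longrightarrow> (deriv ^^ j) (\<lambda>x. c * u x) = (\<lambda>x. c * (deriv ^^ j) u x)"
proof (induction j arbitrary: u)
  case (Suc j)
  have "deriv (\<lambda>x. c * u x) = (\<lambda>x. c * deriv u x)"
    by (rule ext, rule DERIV_imp_deriv) (intro DERIV_cmult smooth_DERIV Suc.prems)
  then show ?case
    using Suc.IH[of "deriv u"] Suc.prems
    by (simp add: funpow_deriv_Suc smooth_deriv del: funpow.simps)
qed simp

lemma smooth_higher_deriv_diff:
  "smooth u \<Longrightarrow> smooth v \<Longrightarrow>
    (deriv ^^ j) (\<lambda>x. u x - v x) = (\<lambda>x. (deriv ^^ j) u x - (deriv ^^ j) v x)"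
  using smooth_higher_deriv_add[of u "\<lambda>x. (-1) * v x" j] smooth_higher_deriv_cmult[of v j "-1"]
    smooth_cmult[of v "-1"] by simp

lemma higher_deriv_const: "(deriv ^^ j) (\<lambda>_. c :: real) = (\<lambda>_. if j = 0 then c else 0)"
proof (induction j)
  case (Suc j)
  then show ?case by (cases j) (auto simp: fun_eq_iff)
qed simp

text \<open>The constant depends on \<psi>, \<open>S\<close> and \<open>k\<close> only, so \<psi>
  can be fixed before the function \<open>h\<close> it multiplies. No Leibniz formula is needed:
  (\<psi> h)' = \<psi>' h + \<psi> h', and the constants of \<psi> and \<psi>' for order
  \<open>k\<close> add up to one for order \<open>Suc k\<close>.\<close>

lemma smooth_higher_deriv_mult_bound:
  assumes "smooth \<psi>" "compact S"
  shows "\<exists>C\<ge>0. \<forall>h \<epsilon>. smooth h \<longrightarrow> (\<forall>j\<le>k. \<forall>x\<in>S. \<bar>(deriv ^^ j) h x\<bar> \<le> \<epsilon>) \<longrightarrow>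
     (\<forall>j\<le>k. \<forall>x\<in>S. \<bar>(deriv ^^ j) (\<lambda>x. \<psi> x * h x) x\<bar> \<le> C * \<epsilon>)"
  using assms(1)
proof (induction k arbitrary: \<psi>)
  case 0
  have "compact (\<psi> ` S)"
    by (intro compact_continuous_image smooth_continuous_on 0 assms)
  then obtain M where "\<forall>y\<in>\<psi> ` S. norm y \<le> M"
    using compact_imp_bounded bounded_iff by metis
  then have M: "\<bar>\<psi> x\<bar> \<le> M" if "x \<in> S" for x using that by simp
  show ?case
  proof (intro exI[of _ "max M 0"] conjI allI impI ballI)
    fix h :: "real \<Rightarrow> real" and \<epsilon> x :: real and j :: nat
    assume "\<forall>j\<le>0. \<forall>x\<in>S. \<bar>(deriv ^^ j) h x\<bar> \<le> \<epsilon>" "j \<le> 0" "x \<in> S"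
    then show "\<bar>(deriv ^^ j) (\<lambda>x. \<psi> x * h x) x\<bar> \<le> max M 0 * \<epsilon>"
      using M[of x] by (auto simp: abs_mult intro!: mult_mono)
  qed simp
next
  case (Suc k)
  from Suc.IH[OF Suc.prems] obtain C1 where C1: "C1 \<ge> 0"
    "\<And>h \<epsilon> j x. smooth h \<Longrightarrow> (\<forall>j\<le>k. \<forall>x\<in>S. \<bar>(deriv ^^ j) h x\<bar> \<le> \<epsilon>) \<Longrightarrow> j \<le> k \<Longrightarrow> x \<in> S \<Longrightarrow>
      \<bar>(deriv ^^ j) (\<lambda>x. \<psi> x * h x) x\<bar> \<le> C1 * \<epsilon>" by metis
  from Suc.IH[OF smooth_deriv[OF Suc.prems]] obtain C2 where C2: "C2 \<ge> 0"
    "\<And>h \<epsilon> j x. smooth h \<Longrightarrow> (\<forall>j\<le>k. \<forall>x\<in>S. \<bar>(deriv ^^ j) h x\<bar> \<le> \<epsilon>) \<Longrightarrow> j \<le> k \<Longrightarrow> x \<in> S \<Longrightarrow>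
      \<bar>(deriv ^^ j) (\<lambda>x. deriv \<psi> x * h x) x\<bar> \<le> C2 * \<epsilon>" by metis
  show ?case
  proof (intro exI[of _ "C1 + C2"] conjI allI impI ballI)
    fix h :: "real \<Rightarrow> real" and \<epsilon> x :: real and j :: nat
    assume h: "smooth h" and *: "\<forall>j\<le>Suc k. \<forall>x\<in>S. \<bar>(deriv ^^ j) h x\<bar> \<le> \<epsilon>"
      and j: "j \<le> Suc k" and x: "x \<in> S"
    have e: "\<epsilon> \<ge> 0" using *[rule_format, of 0 x] x by simp
    have h1: "\<forall>j\<le>k. \<forall>x\<in>S. \<bar>(deriv ^^ j) h x\<bar> \<le> \<epsilon>" using * by simp
    have h2: "\<forall>j\<le>k. \<forall>x\<in>S. \<bar>(deriv ^^ j) (deriv h) x\<bar> \<le> \<epsilon>"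
      using * by (metis Suc_le_mono funpow_deriv_Suc)
    show "\<bar>(deriv ^^ j) (\<lambda>x. \<psi> x * h x) x\<bar> \<le> (C1 + C2) * \<epsilon>"
    proof (cases j)
      case 0
      have "\<bar>\<psi> x * h x\<bar> \<le> C1 * \<epsilon>" using C1(2)[OF h h1, of 0 x] x by simp
      also have "\<dots> \<le> (C1 + C2) * \<epsilon>" using C2(1) e by (simp add: mult_right_mono)
      finally show ?thesis using 0 by simp
    next
      case (Suc i)
      have "deriv (\<lambda>x. \<psi> x * h x) = (\<lambda>x. deriv \<psi> x * h x + \<psi> x * deriv h x)"
        by (rule ext, rule DERIV_imp_deriv)
          (auto intro!: derivative_eq_intros smooth_DERIV Suc.prems h)
      then have "(deriv ^^ j) (\<lambda>x. \<psi> x * h x) x =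
          (deriv ^^ i) (\<lambda>x. deriv \<psi> x * h x) x + (deriv ^^ i) (\<lambda>x. \<psi> x * deriv h x) x"
        using smooth_higher_deriv_add[of "\<lambda>x. deriv \<psi> x * h x" "\<lambda>x. \<psi> x * deriv h x" i] h Suc.prems
        by (simp add: Suc funpow_deriv_Suc smooth_deriv smooth_mult del: funpow.simps)
      moreover have "\<bar>(deriv ^^ i) (\<lambda>x. deriv \<psi> x * h x) x\<bar> \<le> C2 * \<epsilon>"
        by (rule C2(2)) (use h h1 x j Suc in auto)
      moreover have "\<bar>(deriv ^^ i) (\<lambda>x. \<psi> x * deriv h x) x\<bar> \<le> C1 * \<epsilon>"
        by (rule C1(2)) (use h h2 x j Suc in \<open>auto intro: smooth_deriv\<close>)
      ultimately show ?thesis by (simp add: algebra_simps)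
    qed
  qed (use C1 C2 in simp)
qed

text \<open>The formula (f^-1)' = 1 / (f' o f^-1) bootstraps: if the inverse is n times
  differentiable, so is the right-hand side, hence the inverse is so n + 1 times.\<close>

lemma smooth_inv:
  assumes f: "smooth f" and bij: "bij f" and pos: "\<And>x. deriv f x > 0"
  shows "smooth (inv f)"
proof -
  have sm: "strict_mono f"
    using DERIV_pos_imp_increasing[of _ _ f] pos smooth_DERIV[OF f]
    by (metis strict_monoI)
  have cont: "continuous_on UNIV f" by (rule smooth_continuous_on[OF f])
  have D: "(inv f has_real_derivative inverse (deriv f (inv f y))) (at y)" for y
  proof (rule DERIV_inverse_function[where a = "y - 1" and b = "y + 1"])
    show "(f has_real_derivative deriv f (inv f y)) (at (inv f y))" by (rule smooth_DERIV[OF f])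
    have "isCont (inv f) (f (inv f y))"
      by (rule isCont_inverse_function[where d = 1])
        (use bij cont in \<open>auto simp: continuous_on_eq_continuous_at bij_is_inj\<close>)
    then show "isCont (inv f) y" using bij by (simp add: bij_is_surj surj_f_inv_f)
  qed (use pos[of "inv f y"] bij in \<open>auto simp: bij_is_surj surj_f_inv_f\<close>)
  have "ntimes_diff n (inv f)" for n
  proof (induction n)
    case (Suc n)
    have "ntimes_diff n (deriv f \<circ> inv f)"
      using Suc smooth_deriv[OF f] by (intro ntimes_diff_compose) (simp_all add: smooth_iff_ntimes_diff)
    then have "ntimes_diff n (\<lambda>y. inverse ((deriv f \<circ> inv f) y))"
      by (rule ntimes_diff_inverse) (use pos in \<open>simp add: less_imp_neq[THEN not_sym]\<close>)
    then show ?case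
      by (intro ntimes_diff_SucI[OF D]) simp
  qed simp
  then show ?thesis by (simp add: smooth_iff_ntimes_diff)
qed

text \<open>Positivity of the derivative gives injectivity; bounded distance from the identity gives
  surjectivity, by the intermediate value theorem on [y - C, y + C].\<close>

lemma orientation_preserving_diffeoI:
  assumes f: "smooth f" and pos: "\<And>x. deriv f x > 0" and bd: "\<And>x. \<bar>f x - x\<bar> \<le> C"
  shows "orientation_preserving_diffeo f"
proof -
  have "strict_mono f"
    using DERIV_pos_imp_increasing[of _ _ f] pos smooth_DERIV[OF f] by (metis strict_monoI)
  then have inj: "inj f" by (rule strict_mono_imp_inj_on)
  have surj: "surj f"
  proof (rule surjI)
    fix y
    have "C \<ge> 0" using bd[of 0] by linarith
    have "\<exists>x. y - C \<le> x \<and> x \<le> y + C \<and> f x = y"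
      by (rule IVT') (use bd[of "y - C"] bd[of "y + C"] \<open>C \<ge> 0\<close> in
          \<open>auto intro!: smooth_continuous_on[OF f] simp: abs_le_iff\<close>)
    then show "f (SOME x. f x = y) = y" by (metis (mono_tags, lifting) someI)
  qed
  have "bij f" using inj surj by (simp add: bij_def)
  then show ?thesis
    unfolding orientation_preserving_diffeo_def using f pos smooth_inv by blast
qed


subsection \<open>Bump functions and rational polynomial approximation\<close>

lemma poly_times_exp_minus_tendsto_0: "((\<lambda>t::real. poly P t * exp (- t)) \<longlongrightarrow> 0) at_top"
proof -
  have "((\<lambda>t::real. \<Sum>i\<le>degree P. coeff P i * (t ^ i / exp t)) \<longlongrightarrow> (\<Sum>i\<le>degree P. coeff P i * 0)) at_top"
    by (intro tendsto_intros tendsto_power_div_exp_0)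
  also have "(\<lambda>t::real. \<Sum>i\<le>degree P. coeff P i * (t ^ i / exp t)) = (\<lambda>t. poly P t * exp (- t))"
    by (auto simp: fun_eq_iff poly_altdef sum_distrib_right exp_minus divide_inverse mult.assoc)
  finally show ?thesis by simp
qed

text \<open>For \<open>P = 1\<close> this is the classical flat function exp(-1/x). Admitting a
  polynomial factor in 1/x makes the family closed under differentiation.\<close>

definition flat_exp :: "real poly \<Rightarrow> real \<Rightarrow> real" where
  "flat_exp P x = (if x \<le> 0 then 0 else poly P (inverse x) * exp (- inverse x))"

text \<open>With t = 1/x and dt/dx = -t^2, the derivative of P(t) exp(-t) is t^2 (P - P')(t)
  exp(-t). At 0 the right difference quotient is t P(t) exp(-t) for t tending to infinity, hence
  tends to 0.\<close>

lemma DERIV_flat_exp: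
  "(flat_exp P has_real_derivative flat_exp ([:0, 0, 1:] * (P - pderiv P)) x) (at x)"
proof (cases x "0 :: real" rule: linorder_cases)
  case less
  have "((\<lambda>_. 0) has_real_derivative 0) (at x)" by simp
  moreover have "\<forall>\<^sub>F y in nhds x. 0 = flat_exp P y"
    by (rule eventually_mono[OF eventually_nhds_in_open[of "{..<0}" x]])
      (use less in \<open>auto simp: flat_exp_def\<close>)
  ultimately have "(flat_exp P has_real_derivative 0) (at x)"
    by (simp add: DERIV_cong_ev[OF refl _ refl])
  then show ?thesis using less by (simp add: flat_exp_def)
next
  case greater
  have "((\<lambda>x. poly P (inverse x) * exp (- inverse x)) has_real_derivative
      flat_exp ([:0, 0, 1:] * (P - pderiv P)) x) (at x)"
    using greater
    by (auto intro!: derivative_eq_intros DERIV_chain'[OF _ poly_DERIV]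
        simp: flat_exp_def field_simps power2_eq_square)
  moreover have "\<forall>\<^sub>F y in nhds x. poly P (inverse y) * exp (- inverse y) = flat_exp P y"
    by (rule eventually_mono[OF eventually_nhds_in_open[of "{0<..}" x]])
      (use greater in \<open>auto simp: flat_exp_def\<close>)
  ultimately show ?thesis by (simp add: DERIV_cong_ev[OF refl _ refl])
next
  case equal
  have "((\<lambda>h. flat_exp P h / h) \<longlongrightarrow> 0) (at 0)"
  proof (rule filterlim_split_at)
    show "((\<lambda>h. flat_exp P h / h) \<longlongrightarrow> 0) (at_left 0)"
      by (rule tendsto_eventually) (auto simp: eventually_at_filter flat_exp_def)
    have "((\<lambda>h. poly ([:0, 1:] * P) (inverse h) * exp (- inverse h)) \<longlongrightarrow> 0) (at_right 0)"
      by (rule filterlim_compose[OF poly_times_exp_minus_tendsto_0 filterlim_inverse_at_top_right])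
    then show "((\<lambda>h. flat_exp P h / h) \<longlongrightarrow> 0) (at_right (0::real))"
      by (rule Lim_transform_eventually)
        (auto simp: eventually_at_filter flat_exp_def field_simps)
  qed
  then show ?thesis using equal by (simp add: DERIV_def flat_exp_def)
qed

lemma smooth_flat_exp: "smooth (flat_exp P)"
proof -
  have "ntimes_diff n (flat_exp P)" for n
    by (induction n arbitrary: P) (auto intro: ntimes_diff_SucI[OF DERIV_flat_exp])
  then show ?thesis by (simp add: smooth_iff_ntimes_diff)
qed

lemma ex_smooth_bump:
  fixes \<alpha> a b \<beta> :: real
  assumes "\<alpha> < a" "b < \<beta>"
  shows "\<exists>\<psi>. smooth \<psi> \<and> (\<forall>x\<in>{a..b}. \<psi> x = 1) \<and> (\<forall>x. x \<notin> {\<alpha><..<\<beta>} \<longrightarrow> \<psi> x = 0)"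
proof -
  define g where "g = flat_exp 1"
  have sg: "smooth g" by (simp add: g_def smooth_flat_exp)
  have g0: "g x = 0" if "x \<le> 0" for x using that by (simp add: g_def flat_exp_def)
  have gp: "g x > 0" if "x > 0" for x using that by (simp add: g_def flat_exp_def)
  have gnn: "g x \<ge> 0" for x using g0[of x] gp[of x] by fastforce
  have den: "g x + g (1 - x) \<noteq> 0" for x
    using gp[of x] gp[of "1 - x"] gnn[of x] gnn[of "1 - x"] by (cases "x > 0") auto
  \<comment> \<open>A smooth step from 0 to 1. The denominator never vanishes because x and 1 - x
    are not both nonpositive.\<close>
  define S where "S = (\<lambda>x. g x * inverse (g x + g (1 - x)))"
  have sS: "smooth S"
    unfolding S_def
    by (intro smooth_mult smooth_inverse smooth_add sg den
        smooth_compose[OF sg smooth_diff[OF smooth_const smooth_ident]])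
  have S0: "S x = 0" if "x \<le> 0" for x using that by (simp add: S_def g0)
  have S1: "S x = 1" if "x \<ge> 1" for x using that gp[of x] by (simp add: S_def g0)
  \<comment> \<open>A rising and a falling step, rescaled so that the slopes lie over [\<alpha>, a]
    and [b, \<beta>].\<close>
  define \<psi> where "\<psi> = (\<lambda>x. S (inverse (a - \<alpha>) * (x - \<alpha>)) * S (inverse (\<beta> - b) * (\<beta> - x)))"
  show ?thesis
  proof (intro exI[of _ \<psi>] conjI ballI allI impI)
    show "smooth \<psi>"
      unfolding \<psi>_def
      by (intro smooth_mult smooth_compose[OF sS] smooth_cmult smooth_diff smooth_const smooth_ident)
  next
    fix x assume x: "x \<in> {a..b}"
    have "inverse (a - \<alpha>) * (x - \<alpha>) \<ge> 1" "inverse (\<beta> - b) * (\<beta> - x) \<ge> 1"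
      using assms x by (auto simp: field_simps)
    then show "\<psi> x = 1" by (simp add: \<psi>_def S1)
  next
    fix x assume x: "x \<notin> {\<alpha><..<\<beta>}"
    then consider "x \<le> \<alpha>" | "x \<ge> \<beta>" by fastforce
    then show "\<psi> x = 0"
    proof cases
      case 1
      then have "inverse (a - \<alpha>) * (x - \<alpha>) \<le> 0" using assms by (simp add: mult_nonneg_nonpos)
      then show ?thesis by (simp add: \<psi>_def S0)
    next
      case 2
      then have "inverse (\<beta> - b) * (\<beta> - x) \<le> 0" using assms by (simp add: mult_nonneg_nonpos)
      then show ?thesis by (simp add: \<psi>_def S0)
    qed
  qed
qed

section \<open>Polynomials with rational coefficients and approximation by them\<close>

lemma poly_map_poly_add:
  fixes h :: "'a::comm_semiring_0 \<Rightarrow> 'b::comm_semiring_0"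
  assumes "h 0 = 0" "\<And>x y. h (x + y) = h x + h y"
  shows "poly (map_poly h (p + q)) z = poly (map_poly h p) z + poly (map_poly h q) z"
proof -
  have "map_poly h (p + q) = map_poly h p + map_poly h q"
    by (rule poly_eqI) (simp add: coeff_map_poly assms)
  then show ?thesis by simp
qed

lemma poly_map_poly_mult:
  fixes h :: "'a::comm_semiring_0 \<Rightarrow> 'b::comm_semiring_0"
  assumes "h 0 = 0" "\<And>x y. h (x + y) = h x + h y" "\<And>x y. h (x * y) = h x * h y"
  shows "poly (map_poly h (p * q)) z = poly (map_poly h p) z * poly (map_poly h q) z"
  by (induction p)
    (simp_all add: poly_map_poly_add map_poly_smult map_poly_pCons assms algebra_simps)

abbreviation poly_rat :: "rat poly \<Rightarrow> 'a::field_char_0 \<Rightarrow> 'a" where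
  "poly_rat p \<equiv> poly (map_poly of_rat p)"

lemma poly_rat_add [simp]: "poly_rat (p + q) z = poly_rat p z + poly_rat q z"
  by (rule poly_map_poly_add) (simp_all add: of_rat_add)

lemma poly_rat_mult [simp]: "poly_rat (p * q) z = poly_rat p z * poly_rat q z"
  by (rule poly_map_poly_mult) (simp_all add: of_rat_add of_rat_mult)

lemma poly_rat_pCons [simp]: "poly_rat (pCons a p) z = of_rat a + z * poly_rat p z"
  by (simp add: map_poly_pCons)

lemma poly_rat_monom [simp]: "poly_rat (monom a n) z = of_rat a * z ^ n"
  by (simp add: map_poly_monom poly_monom)

lemma DERIV_poly_rat: "(poly_rat p has_real_derivative poly_rat (pderiv p) x) (at x)"
proof -
  have "pderiv (map_poly real_of_rat p) = map_poly of_rat (pderiv p)"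
    by (rule poly_eqI) (simp add: coeff_pderiv coeff_map_poly of_rat_mult of_rat_add)
  then show ?thesis using poly_DERIV[of "map_poly of_rat p" x] by simp
qed

lemma ex_poly_rat_sum: "\<exists>p. \<forall>z. poly_rat p z = (\<Sum>i\<le>n. of_rat (r i) * z ^ i)"
proof (induction n)
  case 0
  show ?case by (rule exI[of _ "[:r 0:]"]) simp
next
  case (Suc n)
  then obtain p where "\<forall>z::'a. poly_rat p z = (\<Sum>i\<le>n. of_rat (r i) * z ^ i)" by blast
  then show ?case by (intro exI[of _ "p + monom (r (Suc n)) (Suc n)"]) simp
qed

lemma ex_pderiv_eq: "\<exists>p. pderiv p = (q :: 'a::field_char_0 poly)"
proof -
  have "\<exists>p. pderiv p = (\<Sum>i\<le>n. monom (coeff q i) i)" for n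
  proof (induction n)
    case 0
    show ?case
      by (rule exI[of _ "monom (coeff q 0) 1"]) (simp add: pderiv_monom)
  next
    case (Suc n)
    then obtain p where "pderiv p = (\<Sum>i\<le>n. monom (coeff q i) i)" by blast
    moreover have "of_nat (Suc (Suc n)) \<noteq> (0 :: 'a)" by (rule of_nat_neq_0)
    ultimately show ?case
      by (intro exI[of _ "p + monom (coeff q (Suc n) / of_nat (Suc (Suc n))) (Suc (Suc n))"])
        (simp add: pderiv_add pderiv_monom del: of_nat_Suc)
  qed
  then show ?thesis using poly_as_sum_of_monoms[of q] by metis
qed

lemma ex_rat_close: "(\<epsilon>::real) > 0 \<Longrightarrow> \<exists>r. \<bar>x - of_rat r\<bar> < \<epsilon>"
  using of_rat_dense[of "x - \<epsilon>" "x + \<epsilon>"] by (auto simp: abs_less_iff) (metis add.commute diff_less_eq less_diff_eq)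

lemma Weierstrass_poly_rat:
  fixes g :: "real \<Rightarrow> real"
  assumes "continuous_on {a..b} g" "\<epsilon> > 0"
  shows "\<exists>p. \<forall>x\<in>{a..b}. \<bar>g x - poly_rat p x\<bar> < \<epsilon>"
proof -
  obtain h where h: "real_polynomial_function h" "\<And>x. x \<in> {a..b} \<Longrightarrow> \<bar>g x - h x\<bar> < \<epsilon> / 2"
    using Stone_Weierstrass_real_polynomial_function[of "{a..b}" g "\<epsilon> / 2"] assms by auto
  obtain c n where c: "h = (\<lambda>x. \<Sum>i\<le>n. c i * x ^ i)"
    using h(1) real_polynomial_function_iff_sum by blast
  define M where "M = max 1 (max \<bar>a\<bar> \<bar>b\<bar>)"
  have M: "M \<ge> 1" "\<bar>x\<bar> \<le> M" if "x \<in> {a..b}" for x using that by (auto simp: M_def)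
  \<comment> \<open>There are n + 1 coefficients to be rounded, and rounding one by less than
    \<delta> changes the value on the interval by at most \<delta> M^n, because \<open>M\<close> is
    at least 1. The total stays within \<epsilon>/2.\<close>
  define \<delta> where "\<delta> = \<epsilon> / (2 * real (Suc n) * M ^ n)"
  have M1: "M \<ge> 1" by (simp add: M_def)
  then have \<delta>: "\<delta> > 0" using assms by (simp add: \<delta>_def)
  then have "\<forall>i. \<exists>r. \<bar>c i - of_rat r\<bar> < \<delta>" using ex_rat_close by blast
  then obtain r where r: "\<And>i. \<bar>c i - of_rat (r i)\<bar> < \<delta>" by metis
  obtain p where p: "\<forall>z::real. poly_rat p z = (\<Sum>i\<le>n. of_rat (r i) * z ^ i)"
    using ex_poly_rat_sum by blast
  show ?thesis
  proof (intro exI[of _ p] ballI)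
    fix x assume x: "x \<in> {a..b}"
    have "\<bar>h x - poly_rat p x\<bar> = \<bar>\<Sum>i\<le>n. (c i - of_rat (r i)) * x ^ i\<bar>"
      by (simp add: c p sum_subtractf algebra_simps)
    also have "\<dots> \<le> (\<Sum>i\<le>n. \<bar>(c i - of_rat (r i)) * x ^ i\<bar>)" by (rule sum_abs)
    also have "\<dots> \<le> (\<Sum>i\<le>n. \<delta> * M ^ n)"
    proof (rule sum_mono)
      fix i assume "i \<in> {..n}"
      then have "\<bar>x\<bar> ^ i \<le> M ^ i" "M ^ i \<le> M ^ n"
        using M(2)[OF x] M1 by (auto intro!: power_mono power_increasing)
      then have "\<bar>x\<bar> ^ i \<le> M ^ n" by linarith
      then show "\<bar>(c i - of_rat (r i)) * x ^ i\<bar> \<le> \<delta> * M ^ n"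
        using r[of i] \<delta> unfolding abs_mult power_abs by (intro mult_mono) auto
    qed
    also have "\<dots> = \<epsilon> / 2" using M1 by (simp add: \<delta>_def field_simps del: of_nat_Suc)
    finally show "\<bar>g x - poly_rat p x\<bar> < \<epsilon>" using h(2)[OF x] by linarith
  qed
qed

text \<open>Approximate g' up to order \<open>k\<close>, take an antiderivative of the approximating
  polynomial (again rational), and adjust its constant so that it nearly agrees with
  \<open>g\<close> at \<open>a\<close>. The mean value inequality carries this over to the whole
  interval.\<close>

lemma smooth_Weierstrass_poly_rat:
  assumes "smooth g" "\<epsilon> > 0" "a \<le> b"
  shows "\<exists>p. \<forall>j\<le>k. \<forall>x\<in>{a..b}. \<bar>(deriv ^^ j) (\<lambda>x. g x - poly_rat p x) x\<bar> < \<epsilon>"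
  using assms(1,2)
proof (induction k arbitrary: g \<epsilon>)
  case 0
  then show ?case using Weierstrass_poly_rat[OF smooth_continuous_on[OF 0(1)], of \<epsilon> a b] by simp
next
  case (Suc k)
  \<comment> \<open>The first bound serves the derivatives, the second the values after integration.
    The summand 1 avoids division by zero when a = b.\<close>
  define \<delta> where "\<delta> = min \<epsilon> (\<epsilon> / (2 * (b - a + 1)))"
  have \<delta>: "\<delta> > 0" "\<delta> \<le> \<epsilon>" "\<delta> * (b - a) \<le> \<epsilon> / 2"
  proof -
    show "\<delta> > 0" "\<delta> \<le> \<epsilon>" using Suc.prems assms(3) by (auto simp: \<delta>_def)
    have "\<delta> * (b - a) \<le> \<epsilon> / (2 * (b - a + 1)) * (b - a + 1)"
      using Suc.prems assms(3) by (intro mult_mono) (auto simp: \<delta>_def)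
    also have "\<dots> = \<epsilon> / 2"
    proof -
      have *: "\<epsilon> / (2 * t) * t = \<epsilon> / 2" if "t \<noteq> 0" for t
        using that by (simp add: field_simps)
      show ?thesis by (rule *) (use assms(3) in simp)
    qed
    finally show "\<delta> * (b - a) \<le> \<epsilon> / 2" .
  qed
  obtain q where q: "\<And>j x. j \<le> k \<Longrightarrow> x \<in> {a..b} \<Longrightarrow>
      \<bar>(deriv ^^ j) (\<lambda>x. deriv g x - poly_rat q x) x\<bar> < \<delta>"
    using Suc.IH[OF smooth_deriv[OF Suc.prems(1)] \<delta>(1)] by blast
  obtain p0 where p0: "pderiv p0 = q" using ex_pderiv_eq by blast
  obtain r where r: "\<bar>(g a - poly_rat p0 a) - of_rat r\<bar> < \<epsilon> / 2"
    using ex_rat_close Suc.prems(2) half_gt_zero by blast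
  define p where "p = p0 + [:r:]"
  have dp: "pderiv p = q" by (simp add: p_def p0 pderiv_add pderiv_pCons)
  define u where "u = (\<lambda>x. g x - poly_rat p x)"
  have Du: "(u has_real_derivative deriv g x - poly_rat q x) (at x)" for x
    unfolding u_def
    by (rule DERIV_diff[OF smooth_DERIV[OF Suc.prems(1)]])
      (use DERIV_poly_rat[of p x] dp in simp)
  have du: "deriv u = (\<lambda>x. deriv g x - poly_rat q x)"
    using Du by (auto intro: DERIV_imp_deriv)
  have u: "\<bar>u x\<bar> < \<epsilon>" if x: "x \<in> {a..b}" for x
  proof -
    have "\<bar>u x - u a\<bar> \<le> \<delta> * \<bar>x - a\<bar>"
      using field_differentiable_bound[of "{a..b}" u "\<lambda>x. deriv g x - poly_rat q x" \<delta> x a]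
        Du q[of 0] x assms(3) by (auto intro: has_field_derivative_at_within less_imp_le)
    also have "\<dots> \<le> \<delta> * (b - a)" using \<delta> x by (intro mult_left_mono) auto
    finally have "\<bar>u x - u a\<bar> \<le> \<epsilon> / 2" using \<delta>(3) by linarith
    moreover have "\<bar>u a\<bar> < \<epsilon> / 2" using r by (simp add: u_def p_def diff_diff_eq)
    ultimately show ?thesis by linarith
  qed
  have "\<bar>(deriv ^^ j) u x\<bar> < \<epsilon>" if "j \<le> Suc k" "x \<in> {a..b}" for j x
  proof (cases j)
    case (Suc i)
    then show ?thesis using q[of i x] that \<delta>(2) by (simp add: funpow_deriv_Suc du del: funpow.simps)
  qed (use u that in simp)
  then show ?case unfolding u_def by blast
qed


subsection \<open>Limits of smooth functions\<close>

text \<open>One stage of the construction of w: blend \<open>w\<close> into a polynomial by a bump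
  function. The finite set \<open>X\<close> will contain one point of each gap treated earlier and
  serves to make the polynomials distinct.\<close>

lemma smooth_patch_poly_rat:
  assumes w: "smooth w" and ord: "\<alpha> < a" "a \<le> b" "b < \<beta>" and eps: "\<epsilon> > 0" and X: "finite X"
  shows "\<exists>w' p. smooth w' \<and> (\<forall>x. x \<notin> {\<alpha><..<\<beta>} \<longrightarrow> w' x = w x) \<and>
    (\<forall>x\<in>{a..b}. w' x = poly_rat p x) \<and>
    (\<forall>j\<le>k. \<forall>x. \<bar>(deriv ^^ j) (\<lambda>x. w' x - w x) x\<bar> \<le> \<epsilon>) \<and>
    (\<forall>x\<in>X. poly_rat p x \<noteq> w x)"
proof -
  obtain \<psi> where \<psi>: "smooth \<psi>" "\<And>x. x \<in> {a..b} \<Longrightarrow> \<psi> x = 1"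
      "\<And>x. x \<notin> {\<alpha><..<\<beta>} \<Longrightarrow> \<psi> x = 0"
    using ex_smooth_bump[OF ord(1,3)] by blast
  obtain C where C: "C \<ge> 0" "\<And>h \<epsilon> j x. smooth h \<Longrightarrow>
      (\<forall>j\<le>k. \<forall>x\<in>{\<alpha>..\<beta>}. \<bar>(deriv ^^ j) h x\<bar> \<le> \<epsilon>) \<Longrightarrow> j \<le> k \<Longrightarrow> x \<in> {\<alpha>..\<beta>} \<Longrightarrow>
      \<bar>(deriv ^^ j) (\<lambda>x. \<psi> x * h x) x\<bar> \<le> C * \<epsilon>"
    using smooth_higher_deriv_mult_bound[OF \<psi>(1) compact_Icc[of \<alpha> \<beta>], where k = k] by metis
  define e where "e = \<epsilon> / (C + 1)"
  have e: "e > 0" "C * e \<le> \<epsilon>" using C(1) eps by (auto simp: e_def field_simps)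
  have "\<exists>p. \<forall>j\<le>k. \<forall>x\<in>{\<alpha>..\<beta>}. \<bar>(deriv ^^ j) (\<lambda>x. w x - poly_rat p x) x\<bar> < e / 2"
    by (rule smooth_Weierstrass_poly_rat[OF w]) (use e ord in auto)
  then obtain p0 where p0: "\<And>j x. j \<le> k \<Longrightarrow> x \<in> {\<alpha>..\<beta>} \<Longrightarrow>
      \<bar>(deriv ^^ j) (\<lambda>x. w x - poly_rat p0 x) x\<bar> < e / 2"
    by blast
  \<comment> \<open>Approximation leaves the additive constant of the polynomial free within e/2.
    Each point of \<open>X\<close> forbids at most one constant, so some rational in (0, e0) is
    admissible.\<close>
  obtain e0 :: rat where e0: "0 < e0" "of_rat e0 < e / 2"
    using of_rat_dense[of 0 "e / 2"] e by auto
  define bad where "bad = real_of_rat -` ((\<lambda>x. w x - poly_rat p0 x) ` X)"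
  have "finite bad"
    unfolding bad_def by (intro finite_vimageI finite_imageI X injI) simp
  moreover have "infinite {0<..<e0}" using e0 by simp
  ultimately obtain \<delta> where \<delta>: "\<delta> \<in> {0<..<e0}" "\<delta> \<notin> bad"
    by (meson finite_subset subsetI)
  have \<delta>e: "\<bar>real_of_rat \<delta>\<bar> \<le> e / 2"
  proof -
    have "0 < real_of_rat \<delta>" "real_of_rat \<delta> < real_of_rat e0"
      using \<delta>(1) by (auto simp: of_rat_less)
    then show ?thesis using e0(2) by linarith
  qed
  define p where "p = p0 + [:\<delta>:]"
  define h where "h = (\<lambda>x. poly_rat p x - w x)"
  have sh: "smooth h" unfolding h_def by (intro smooth_diff smooth_poly w)
  have h: "\<bar>(deriv ^^ j) h x\<bar> \<le> e" if "j \<le> k" "x \<in> {\<alpha>..\<beta>}" for j x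
  proof -
    have "h = (\<lambda>x. of_rat \<delta> - (w x - poly_rat p0 x))" by (auto simp: h_def p_def)
    then have "(deriv ^^ j) h x =
        (if j = 0 then of_rat \<delta> else 0) - (deriv ^^ j) (\<lambda>x. w x - poly_rat p0 x) x"
      by (simp only: smooth_higher_deriv_diff smooth_const smooth_diff w smooth_poly higher_deriv_const)
    then have "\<bar>(deriv ^^ j) h x\<bar> \<le> \<bar>if j = 0 then real_of_rat \<delta> else 0\<bar> +
        \<bar>(deriv ^^ j) (\<lambda>x. w x - poly_rat p0 x) x\<bar>"
      by (simp only: abs_triangle_ineq4)
    moreover have "\<bar>if j = 0 then real_of_rat \<delta> else 0\<bar> \<le> e / 2"
      using \<delta>e e by (simp only: split: if_splits) simp
    ultimately show ?thesis using p0[OF that] by linarith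
  qed
  define w' where "w' = (\<lambda>x. w x + \<psi> x * h x)"
  have diff: "(\<lambda>x. w' x - w x) = (\<lambda>x. \<psi> x * h x)" by (simp add: w'_def)
  show ?thesis
  proof (intro exI[of _ w'] exI[of _ p] conjI allI impI ballI)
    show "smooth w'" unfolding w'_def by (intro smooth_add smooth_mult w \<psi>(1) sh)
    show "w' x = w x" if "x \<notin> {\<alpha><..<\<beta>}" for x using \<psi>(3)[OF that] by (simp add: w'_def)
    show "w' x = poly_rat p x" if "x \<in> {a..b}" for x
      using \<psi>(2)[OF that] by (simp add: w'_def h_def)
    show "poly_rat p x \<noteq> w x" if "x \<in> X" for x
      using \<delta>(2) that by (auto simp: p_def bad_def image_iff)
    fix j x assume j: "j \<le> k"
    show "\<bar>(deriv ^^ j) (\<lambda>x. w' x - w x) x\<bar> \<le> \<epsilon>"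
    proof (cases "x \<in> {\<alpha>..\<beta>}")
      case True
      have "\<bar>(deriv ^^ j) (\<lambda>x. \<psi> x * h x) x\<bar> \<le> C * e"
        by (rule C(2)) (use sh h j True in auto)
      then show ?thesis using e diff by simp
    next
      case False
      \<comment> \<open>Off the closed interval \<psi> vanishes in a neighbourhood, so all
        derivatives do. Its endpoints belong to the other case, where the estimate on the compact
        interval applies.\<close>
      have "(deriv ^^ j) (\<lambda>x. \<psi> x * h x) x = (deriv ^^ j) (\<lambda>_. 0) x"
      proof (rule higher_deriv_cong_ev[OF _ refl])
        have "\<forall>\<^sub>F y in nhds x. y \<in> - {\<alpha>..\<beta>}"
          by (rule eventually_nhds_in_open) (use False in \<open>auto intro: open_Compl\<close>)
        then show "\<forall>\<^sub>F y in nhds x. \<psi> y * h y = 0"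
          by (rule eventually_mono) (auto simp: \<psi>(3))
      qed
      then show ?thesis using eps diff by (simp add: higher_deriv_const)
    qed
  qed
qed

text \<open>For fixed \<open>j\<close> the geometric bound holds for all but finitely many
  \<open>n\<close>, which suffices for uniform convergence of every differentiated series. For j
  \<le> k it holds from n = 0 on, and the series of bounds sums to exactly \<eta>.\<close>

lemma smooth_limit:
  fixes W :: "nat \<Rightarrow> real \<Rightarrow> real"
  assumes W: "\<And>n. smooth (W n)" and W0: "W 0 = (\<lambda>_. 0)"
    and bd: "\<And>n j x. j \<le> n + k \<Longrightarrow>
      \<bar>(deriv ^^ j) (\<lambda>x. W (Suc n) x - W n x) x\<bar> \<le> \<eta> * (1 / 2) ^ Suc n"
  shows "\<exists>w. smooth w \<and> (\<forall>x. (\<lambda>n. W n x) \<longlonglongrightarrow> w x) \<and> (\<forall>j\<le>k. \<forall>x. \<bar>(deriv ^^ j) w x\<bar> \<le> \<eta>)"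
proof -
  define \<phi> where "\<phi> = (\<lambda>n x. W (Suc n) x - W n x)"
  define M where "M = (\<lambda>n. \<eta> * (1 / 2) ^ Suc n)"
  \<comment> \<open>The candidates for all derivatives of the limit at once; termwise
    differentiation shows that \<open>V (Suc j)\<close> is the derivative of
    \<open>V j\<close>.\<close>
  define V where "V = (\<lambda>j x. \<Sum>n. (deriv ^^ j) (\<phi> n) x)"
  have s\<phi>: "smooth (\<phi> n)" for n unfolding \<phi>_def by (intro smooth_diff W)
  have "M sums (\<eta> * 1)" unfolding M_def by (intro sums_mult power_half_series)
  then have M: "summable M" "suminf M = \<eta>" by (auto simp: sums_iff)
  have bd\<phi>: "\<bar>(deriv ^^ j) (\<phi> n) x\<bar> \<le> M n" if "j \<le> n + k" for j n x
    using bd[OF that] by (simp add: \<phi>_def M_def)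
  have uc: "uniformly_convergent_on UNIV (\<lambda>n x. \<Sum>i<n. (deriv ^^ j) (\<phi> i) x)" for j
  proof (rule Weierstrass_m_test'_ev[OF _ M(1)])
    show "\<forall>\<^sub>F n in sequentially. \<forall>x\<in>UNIV. norm ((deriv ^^ j) (\<phi> n) x) \<le> M n"
      using eventually_ge_at_top[of j] by eventually_elim (simp add: bd\<phi>)
  qed
  have summ: "summable (\<lambda>n. (deriv ^^ j) (\<phi> n) x)" for j x
  proof (rule summable_comparison_test_ev[OF _ M(1)])
    show "\<forall>\<^sub>F n in sequentially. norm ((deriv ^^ j) (\<phi> n) x) \<le> M n"
      using eventually_ge_at_top[of j] by eventually_elim (simp add: bd\<phi>)
  qed
  have DV: "(V j has_real_derivative V (Suc j) x) (at x)" for j x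
    unfolding V_def
  proof (rule has_field_derivative_series'(2)[where S = UNIV and ?x0.0 = 0])
    show "((deriv ^^ j) (\<phi> n) has_real_derivative (deriv ^^ Suc j) (\<phi> n) x) (at x)" for n x
      using smooth_DERIV[OF smooth_higher_deriv[OF s\<phi>]] by simp
  qed (use uc[of "Suc j"] summ in auto)
  have sV: "ntimes_diff n (V j)" for n j
    by (induction n arbitrary: j) (auto intro: ntimes_diff_SucI[OF DV])
  have dV: "(deriv ^^ j) (V 0) = V j" for j
    by (induction j) (auto intro!: DERIV_imp_deriv DV)
  show ?thesis
  proof (intro exI[of _ "V 0"] conjI allI impI)
    show "smooth (V 0)" using sV by (simp add: smooth_iff_ntimes_diff)
    fix x
    have "(\<lambda>n. \<Sum>i<n. \<phi> i x) \<longlonglongrightarrow> V 0 x"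
      using summable_LIMSEQ[OF summ[of 0 x]] by (simp add: V_def)
    moreover have "(\<Sum>i<n. \<phi> i x) = W n x" for n
      using sum_lessThan_telescope[of "\<lambda>i. W i x" n] by (simp add: \<phi>_def W0)
    ultimately show "(\<lambda>n. W n x) \<longlonglongrightarrow> V 0 x" by simp
  next
    fix j x assume j: "j \<le> k"
    have b: "norm ((deriv ^^ j) (\<phi> n) x) \<le> M n" for n using bd\<phi>[of j n x] j by simp
    have "norm (V j x) \<le> (\<Sum>n. norm ((deriv ^^ j) (\<phi> n) x))"
      unfolding V_def
      by (rule summable_norm, rule summable_comparison_test[OF _ M(1)]) (use b in auto)
    also have "\<dots> \<le> suminf M"
      by (rule suminf_le[OF b _ M(1)], rule summable_comparison_test[OF _ M(1)]) (use b in auto)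
    finally show "\<bar>(deriv ^^ j) (V 0) x\<bar> \<le> \<eta>" by (simp add: dV M)
  qed
qed

section \<open>Seminorms and convergence in the smooth topology\<close>

lemma abs_higher_deriv_le_seminorm:
  assumes "smooth u" "j \<le> r" "x \<in> {- real A..real A}"
  shows "\<bar>(deriv ^^ j) u x\<bar> \<le> smooth_seminorm A r u"
proof -
  have "compact ((\<lambda>x. \<bar>(deriv ^^ j) u x\<bar>) ` {- real A..real A})"
    by (intro compact_continuous_image continuous_intros smooth_continuous_on smooth_higher_deriv assms)
      simp
  then have "bdd_above ((\<lambda>x. \<bar>(deriv ^^ j) u x\<bar>) ` {- real A..real A})"
    by (intro bounded_imp_bdd_above compact_imp_bounded)
  then have "\<bar>(deriv ^^ j) u x\<bar> \<le> (SUP x\<in>{- real A..real A}. \<bar>(deriv ^^ j) u x\<bar>)"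
    using assms(3) by (rule cSUP_upper2) simp
  also have "\<dots> \<le> smooth_seminorm A r u"
    unfolding smooth_seminorm_def by (rule Max_ge) (use assms in auto)
  finally show ?thesis .
qed

lemma smooth_seminorm_le:
  assumes "\<And>j x. j \<le> r \<Longrightarrow> x \<in> {- real A..real A} \<Longrightarrow> \<bar>(deriv ^^ j) u x\<bar> \<le> c"
  shows "smooth_seminorm A r u \<le> c"
  unfolding smooth_seminorm_def
  by (rule Max.boundedI) (auto intro!: cSUP_least assms)

lemma smooth_seminorm_triangle:
  assumes "smooth u" "smooth v"
  shows "smooth_seminorm A r (\<lambda>x. u x + v x) \<le> smooth_seminorm A r u + smooth_seminorm A r v"
proof (rule smooth_seminorm_le)
  fix j x assume "j \<le> r" "x \<in> {- real A..real A}"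
  then show "\<bar>(deriv ^^ j) (\<lambda>x. u x + v x) x\<bar> \<le> smooth_seminorm A r u + smooth_seminorm A r v"
    using abs_higher_deriv_le_seminorm[OF assms(1)] abs_higher_deriv_le_seminorm[OF assms(2)]
    by (simp add: smooth_higher_deriv_add[OF assms])
      (meson abs_triangle_ineq add_mono order_trans)
qed

text \<open>Induction over the generation of open sets reduces the claim to subbasic balls. These
  may be centred at any \<open>v\<close>, not at the limit, so the triangle inequality is used with
  the slack that \<open>u\<close> has inside the ball.\<close>

lemma limitin_smooth_topologyI:
  assumes F: "\<And>n. smooth (F n)" and u: "smooth u"
    and lim: "\<And>A r. (\<lambda>n. smooth_seminorm A r (\<lambda>x. F n x - u x)) \<longlonglongrightarrow> 0"
  shows "limitin smooth_topology F u sequentially"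
  unfolding limitin_def
proof (intro conjI allI impI)
  show "u \<in> topspace smooth_topology" using u by (simp add: topspace_smooth_topology)
  fix U assume "openin smooth_topology U \<and> u \<in> U"
  then have "generate_topology_on {{v. smooth v \<and> smooth_seminorm A r (\<lambda>x. v x - u x) < \<epsilon>} |
      u A r \<epsilon>. smooth u \<and> \<epsilon> > 0} U" "u \<in> U"
    by (auto simp: smooth_topology_def openin_topology_generated_by_iff)
  then show "\<forall>\<^sub>F n in sequentially. F n \<in> U"
  proof (induction rule: generate_topology_on.induct)
    case (Int a b)
    then show ?case by (auto simp: eventually_conj_iff)
  next
    case (UN K)
    then obtain k where "k \<in> K" "u \<in> k" by blast
    with UN have "\<forall>\<^sub>F n in sequentially. F n \<in> k" by blast
    then show ?case by (rule eventually_mono) (use \<open>k \<in> K\<close> in blast)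
  next
    case (Basis s)
    then obtain v A r \<epsilon> where s: "s = {w. smooth w \<and> smooth_seminorm A r (\<lambda>x. w x - v x) < \<epsilon>}"
      and v: "smooth v" by blast
    have "smooth_seminorm A r (\<lambda>x. u x - v x) < \<epsilon>" using Basis s by simp
    then have "\<forall>\<^sub>F n in sequentially. smooth_seminorm A r (\<lambda>x. F n x - u x) <
        \<epsilon> - smooth_seminorm A r (\<lambda>x. u x - v x)"
      using order_tendstoD(2)[OF lim[of A r]] by simp
    then show ?case
    proof (rule eventually_mono)
      fix n assume "smooth_seminorm A r (\<lambda>x. F n x - u x) < \<epsilon> - smooth_seminorm A r (\<lambda>x. u x - v x)"
      then show "F n \<in> s"
        using smooth_seminorm_triangle[OF smooth_diff[OF F[of n] u] smooth_diff[OF u v], of A r] F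
        by (simp add: s)
    qed
  qed simp
qed


subsection \<open>Polynomials on the gaps of a perfect set\<close>

locale perfect_nowhere_dense =
  fixes E :: "real set"
  assumes nonempty: "E \<noteq> {}" and compact: "compact E" and perfect: "perfect_set E"
    and nowhere_dense: "interior (closure E) = {}"
begin

text \<open>The bounded components of the complement, coded by their endpoints. The two unbounded
  components are kept apart because w is zero there.\<close>

definition gaps :: "(real \<times> real) set" where
  "gaps = {(a, b). a < b \<and> a \<in> E \<and> b \<in> E \<and> {a<..<b} \<inter> E = {}}"

lemma gapsD:
  assumes "(a, b) \<in> gaps"
  shows "a < b" "a \<in> E" "b \<in> E" "\<And>x. x \<in> E \<Longrightarrow> x \<le> a \<or> b \<le> x"
  using assms by (auto simp: gaps_def disjoint_iff not_le)

lemma closed: "closed E"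
  using compact by (rule compact_imp_closed)

lemma bdd: "bdd_above E" "bdd_below E"
  using compact_imp_bounded[OF compact] by (auto intro: bounded_imp_bdd_above bounded_imp_bdd_below)

lemma Inf_le: "x \<in> E \<Longrightarrow> Inf E \<le> x" and le_Sup: "x \<in> E \<Longrightarrow> x \<le> Sup E"
  using bdd by (auto intro: cInf_lower cSup_upper)

lemma Inf_mem: "Inf E \<in> E" and Sup_mem: "Sup E \<in> E"
  using closed_contains_Inf closed_contains_Sup nonempty bdd closed by auto

lemma not_isolated:
  assumes "e \<in> E" "open T" "e \<in> T"
  shows "\<exists>y\<in>E. y \<in> T \<and> y \<noteq> e"
proof (rule ccontr)
  assume "\<not> ?thesis"
  then have "T \<inter> E = {e}" using assms(1,3) by blast
  then have "e isolated_in E" using assms(1,2) by (meson isolated_in_def)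
  then show False using perfect by (simp add: perfect_set_def)
qed

text \<open>Perfectness enters here: an endpoint common to two gaps would be isolated in
  \<open>E\<close>. Disjointness of the closures leaves room for a bump function around one gap that
  vanishes on finitely many others.\<close>

lemma gaps_separated:
  assumes g: "(a, b) \<in> gaps" and h: "(c, d) \<in> gaps" and ne: "(a, b) \<noteq> (c, d)"
  shows "b < c \<or> d < a"
proof -
  note G = gapsD[OF g] and H = gapsD[OF h]
  have adj: "z \<noteq> x" if yz: "(y, z) \<in> gaps" and xt: "(x, t) \<in> gaps" for x y z t
  proof
    assume "z = x"
    note Y = gapsD[OF yz] and X = gapsD[OF xt]
    obtain u where "u \<in> E" "u \<in> {y<..<t}" "u \<noteq> x"
      using not_isolated[of x "{y<..<t}"] X(1,2) Y(1) \<open>z = x\<close> by auto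
    then show False
      using Y(4)[of u] X(4)[of u] \<open>z = x\<close> by auto
  qed
  have "b \<noteq> c" "d \<noteq> a" using adj g h by blast+
  moreover have "c \<le> a \<or> b \<le> c" "d \<le> a \<or> b \<le> d" using G(4) H by auto
  moreover have "a \<le> c \<or> d \<le> a" "b \<le> c \<or> d \<le> b" using H(4) G by auto
  ultimately show ?thesis using ne G(1) H(1) by auto
qed

text \<open>The endpoints are the last point of \<open>E\<close> before \<open>x\<close> and the
  first one after it; closedness puts both into \<open>E\<close>.\<close>

lemma mem_gap:
  assumes "x \<notin> E" "Inf E \<le> x" "x \<le> Sup E"
  obtains a b where "(a, b) \<in> gaps" "a < x" "x < b"
proof -
  define L R where "L = E \<inter> {..x}" and "R = E \<inter> {x..}"
  have L: "L \<noteq> {}" "closed L" "bdd_above L" and R: "R \<noteq> {}" "closed R" "bdd_below R"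
    using assms Inf_mem Sup_mem closed by (auto simp: L_def R_def intro: closed_Int)
  have SL: "Sup L \<in> L" and IR: "Inf R \<in> R"
    using closed_contains_Sup closed_contains_Inf L R by auto
  have ax: "Sup L < x" "x < Inf R"
    using SL IR assms(1) by (auto simp: L_def R_def order.strict_iff_order)
  have "y \<le> Sup L \<or> Inf R \<le> y" if "y \<in> E" for y
    using that L(3) R(3) by (cases "y \<le> x") (auto simp: L_def R_def intro: cSup_upper cInf_lower)
  then have "(Sup L, Inf R) \<in> gaps"
    using ax SL IR by (fastforce simp: gaps_def L_def R_def)
  then show thesis using ax that by blast
qed

lemma gap_between:
  assumes "x \<in> E" "y \<in> E" "x < y"
  obtains a b where "(a, b) \<in> gaps" "x \<le> a" "b \<le> y"
proof -
  have "\<not> {x<..<y} \<subseteq> E"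
  proof
    assume "{x<..<y} \<subseteq> E"
    then have "{x<..<y} \<subseteq> interior (closure E)"
      using closure_subset by (intro interior_maximal) auto
    then show False using nowhere_dense dense[OF assms(3)] by auto
  qed
  then obtain u where u: "u \<in> {x<..<y}" "u \<notin> E" by blast
  then have "Inf E \<le> u" "u \<le> Sup E"
    using Inf_le[OF assms(1)] le_Sup[OF assms(2)] by auto
  then obtain a b where ab: "(a, b) \<in> gaps" "a < u" "u < b"
    using mem_gap[OF u(2)] by blast
  then show thesis
    using gapsD(4)[OF ab(1) assms(1)] gapsD(4)[OF ab(1) assms(2)] u that by auto
qed

text \<open>Supplies two branches with different polynomials arbitrarily close to \<open>e\<close>,
  which will contradict analyticity there.\<close>

lemma two_gaps_near:
  assumes e: "e \<in> E" and \<delta>: "\<delta> > 0"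
  obtains a b c d where "(a, b) \<in> gaps" "(c, d) \<in> gaps" "(a, b) \<noteq> (c, d)"
    "e - \<delta> < a" "b < e + \<delta>" "e - \<delta> < c" "d < e + \<delta>"
proof -
  have near: "\<exists>a b. (a, b) \<in> gaps \<and> e - r < a \<and> b < e + r" if r: "r > 0" for r
  proof -
    obtain y where y: "y \<in> E" "y \<in> {e - r<..<e + r}" "y \<noteq> e"
      using not_isolated[OF e, of "{e - r<..<e + r}"] r by auto
    then consider "y < e" | "e < y" by linarith
    then show ?thesis
    proof cases
      case 1
      obtain a b where ab: "(a, b) \<in> gaps" "y \<le> a" "b \<le> e" using gap_between[OF y(1) e 1] .
      then show ?thesis using y(2) r by (intro exI[of _ a] exI[of _ b]) auto
    next
      case 2
      obtain a b where ab: "(a, b) \<in> gaps" "e \<le> a" "b \<le> y" using gap_between[OF e y(1) 2] .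
      then show ?thesis using y(2) r by (intro exI[of _ a] exI[of _ b]) auto
    qed
  qed
  obtain a b where ab: "(a, b) \<in> gaps" "e - \<delta> < a" "b < e + \<delta>" using near[OF \<delta>] by blast
  define r where "r = b - a"
  have r: "r > 0" using gapsD(1)[OF ab(1)] by (simp add: r_def)
  \<comment> \<open>A gap between e - r/2 and e + r/2 is shorter than r, the length of the first
    gap, so it is a different one.\<close>
  obtain c d where cd: "(c, d) \<in> gaps" "e - min \<delta> (r / 2) < c" "d < e + min \<delta> (r / 2)"
    using near[of "min \<delta> (r / 2)"] r \<delta> by auto
  have "(a, b) \<noteq> (c, d)"
  proof
    assume "(a, b) = (c, d)"
    then have "e - r / 2 < a" "b < e + r / 2" using cd(2,3) by auto
    then show False by (simp add: r_def field_simps)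
  qed
  then show thesis using ab cd by (intro that[of a b c d]) auto
qed

text \<open>A gap starting at the minimum or ending at the maximum of \<open>E\<close> would isolate
  that point. Strictness lets the bump functions stay inside the hull.\<close>

lemma gap_subset_hull: "(a, b) \<in> gaps \<Longrightarrow> Inf E < a \<and> b < Sup E"
proof -
  assume ab: "(a, b) \<in> gaps"
  note G = gapsD[OF ab]
  have "Inf E \<noteq> a"
  proof
    assume "Inf E = a"
    then show False
      using not_isolated[OF G(2), of "{..<b}"] G Inf_le by force
  qed
  moreover have "Sup E \<noteq> b"
  proof
    assume "Sup E = b"
    then show False
      using not_isolated[OF G(3), of "{a<..}"] G le_Sup by force
  qed
  ultimately show ?thesis using Inf_le[OF G(2)] le_Sup[OF G(3)] by auto
qed

text \<open>Otherwise the gaps have a least length r, but some gap lies in an interval of length r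
  around the minimum of \<open>E\<close>.\<close>

lemma infinite_gaps: "infinite gaps"
proof
  assume fin: "finite gaps"
  define r where "r = Min (insert 1 ((\<lambda>(a, b). b - a) ` gaps))"
  have r: "r > 0" unfolding r_def using fin by (auto simp: gaps_def)
  have le: "r \<le> b - a" if "(a, b) \<in> gaps" for a b
    unfolding r_def by (rule Min_le) (use fin that in force)+
  obtain a b c d where "(a, b) \<in> gaps" "Inf E - r / 2 < a" "b < Inf E + r / 2"
    by (rule two_gaps_near[OF Inf_mem, of "r / 2"]) (use r in auto)
  then show False using le[of a b] by linarith
qed

lemma countable_gaps: "countable gaps"
proof -
  define f where "f = (\<lambda>(a, b). SOME r. a < real_of_rat r \<and> real_of_rat r < b)"
  have f: "a < real_of_rat (f (a, b)) \<and> real_of_rat (f (a, b)) < b" if "(a, b) \<in> gaps" for a b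
    unfolding f_def using someI_ex[OF of_rat_dense[OF gapsD(1)[OF that]]] by simp
  have "inj_on f gaps"
  proof (rule inj_onI, clarify)
    fix a b c d assume g: "(a, b) \<in> gaps" and h: "(c, d) \<in> gaps" and eq: "f (a, b) = f (c, d)"
    show "a = c \<and> b = d"
      using gaps_separated[OF g h] f[OF g] f[OF h] eq by fastforce
  qed
  then show ?thesis by (rule countable_image_inj_on[rotated]) simp
qed

lemma ex_smooth_poly_on_gaps:
  assumes \<eta>: "\<eta> > 0"
  shows "\<exists>w p. smooth w \<and> (\<forall>x. x \<le> Inf E \<or> Sup E \<le> x \<longrightarrow> w x = 0) \<and>
    (\<forall>j\<le>k. \<forall>x. \<bar>(deriv ^^ j) w x\<bar> \<le> \<eta>) \<and>
    (\<forall>(a, b)\<in>gaps. \<forall>x\<in>{a..b}. w x = poly_rat (p (a, b)) x) \<and> inj_on p gaps"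
proof -
  define G where "G = from_nat_into gaps"
  have G: "bij_betw G UNIV gaps"
    unfolding G_def by (rule bij_betw_from_nat_into[OF countable_gaps infinite_gaps])
  define A B where "A = (\<lambda>n. fst (G n))" and "B = (\<lambda>n. snd (G n))"
  have AB: "(A n, B n) \<in> gaps" for n
    using G by (auto simp: A_def B_def bij_betw_def)
  have ABne: "(A m, B m) \<noteq> (A n, B n)" if "m \<noteq> n" for m n
    using G that by (auto simp: A_def B_def bij_betw_def inj_on_def prod_eq_iff)
  \<comment> \<open>Room for the n-th bump: the closed gap lies in an open set that stays inside the
    hull and misses the closed gaps with smaller index.\<close>
  have "\<exists>\<alpha> \<beta>. \<alpha> < A n \<and> B n < \<beta> \<and> {\<alpha><..<\<beta>} \<subseteq> {Inf E<..<Sup E} - (\<Union>i<n. {A i..B i})" for n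
  proof -
    define V where "V = {Inf E<..<Sup E} - (\<Union>i<n. {A i..B i})"
    have V: "open V" unfolding V_def by (intro open_Diff closed_UN) auto
    have sub: "{A n..B n} \<subseteq> V"
    proof
      fix x assume x: "x \<in> {A n..B n}"
      have "x \<notin> {A i..B i}" if "i < n" for i
        using gaps_separated[OF AB AB ABne, of i n] that x by auto
      then show "x \<in> V" using gap_subset_hull[OF AB[of n]] x by (auto simp: V_def)
    qed
    have An: "A n \<in> V" "B n \<in> V" using sub gapsD(1)[OF AB[of n]] by auto
    obtain r where r: "r > 0" "\<And>x. \<bar>x - A n\<bar> < r \<Longrightarrow> x \<in> V"
      using V An(1) unfolding open_real by blast
    obtain s where s: "s > 0" "\<And>x. \<bar>x - B n\<bar> < s \<Longrightarrow> x \<in> V"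
      using V An(2) unfolding open_real by blast
    have "{A n - r<..<B n + s} \<subseteq> V"
    proof
      fix x assume "x \<in> {A n - r<..<B n + s}"
      then consider "x \<in> {A n..B n}" | "\<bar>x - A n\<bar> < r" | "\<bar>x - B n\<bar> < s" by fastforce
      then show "x \<in> V" using r s sub by cases auto
    qed
    then show ?thesis using r(1) s(1) unfolding V_def
      by (intro exI[of _ "A n - r"] exI[of _ "B n + s"]) auto
  qed
  then obtain \<alpha> \<beta> where \<alpha>\<beta>: "\<And>n. \<alpha> n < A n" "\<And>n. B n < \<beta> n"
      "\<And>n. {\<alpha> n<..<\<beta> n} \<subseteq> {Inf E<..<Sup E} - (\<Union>i<n. {A i..B i})"
    by metis
  \<comment> \<open>The midpoints witness distinctness: at stage n the polynomial is chosen to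
    differ from \<open>W n\<close> at \<open>mid i\<close> for every i < n, and there
    \<open>W n\<close> already has the value of the i-th polynomial.\<close>
  define mid where "mid = (\<lambda>n. (A n + B n) / 2)"
  have mid: "mid n \<in> {A n..B n}" for n using gapsD(1)[OF AB[of n]] by (simp add: mid_def)
  \<comment> \<open>\<open>P\<close> and \<open>Q\<close> package the invariant and the step
    relation for dependent choice; the clause for 0 pins the start to the zero function.\<close>
  define P where "P = (\<lambda>n (w :: real \<Rightarrow> real). smooth w \<and> (n = (0::nat) \<longrightarrow> w = (\<lambda>_. 0)))"
  define Q where "Q = (\<lambda>n w w'. (\<forall>x. x \<notin> {\<alpha> n<..<\<beta> n} \<longrightarrow> w' x = w x) \<and>
    (\<forall>j\<le>n + k. \<forall>x. \<bar>(deriv ^^ j) (\<lambda>x. w' x - w x) x\<bar> \<le> \<eta> * (1 / 2) ^ Suc n) \<and>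
    (\<exists>p. (\<forall>x\<in>{A n..B n}. w' x = poly_rat p x) \<and> (\<forall>x\<in>mid ` {..<n}. poly_rat p x \<noteq> w x)))"
  have "\<exists>W. \<forall>n. P n (W n) \<and> Q n (W n) (W (Suc n))"
  proof (rule dependent_nat_choice)
    show "\<exists>w. P 0 w" by (simp add: P_def smooth_const)
  next
    fix w n assume "P n w"
    then have w: "smooth w" by (simp add: P_def)
    have "\<eta> * (1 / 2) ^ Suc n > 0" using \<eta> by simp
    from smooth_patch_poly_rat[OF w \<alpha>\<beta>(1) less_imp_le[OF gapsD(1)[OF AB]] \<alpha>\<beta>(2) this,
        where k = "n + k" and X = "mid ` {..<n}"]
    show "\<exists>w'. P (Suc n) w' \<and> Q n w w'" unfolding P_def Q_def by blast
  qed
  then obtain W where PQ: "\<And>n. P n (W n)" "\<And>n. Q n (W n) (W (Suc n))" by blast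
  have W: "\<And>n. smooth (W n)" "W 0 = (\<lambda>_. 0)" using PQ(1) by (auto simp: P_def)
  have W_out: "W (Suc n) x = W n x" if "x \<notin> {\<alpha> n<..<\<beta> n}" for n x
    using PQ(2)[of n] that by (simp add: Q_def)
  have "\<exists>p. \<forall>n. (\<forall>x\<in>{A n..B n}. W (Suc n) x = poly_rat (p n) x) \<and>
      (\<forall>x\<in>mid ` {..<n}. poly_rat (p n) x \<noteq> W n x)"
    using PQ(2) unfolding Q_def by metis
  then obtain p where p: "\<And>n x. x \<in> {A n..B n} \<Longrightarrow> W (Suc n) x = poly_rat (p n) x"
      "\<And>n i. i < n \<Longrightarrow> poly_rat (p n) (mid i) \<noteq> W n (mid i)"
    by blast
  obtain w where w: "smooth w" "\<And>x. (\<lambda>n. W n x) \<longlonglongrightarrow> w x"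
      "\<And>j x. j \<le> k \<Longrightarrow> \<bar>(deriv ^^ j) w x\<bar> \<le> \<eta>"
  proof -
    have "\<bar>(deriv ^^ j) (\<lambda>x. W (Suc n) x - W n x) x\<bar> \<le> \<eta> * (1 / 2) ^ Suc n"
      if "j \<le> n + k" for n j x
      using PQ(2)[of n] that by (simp add: Q_def)
    from smooth_limit[where W = W and k = k, OF W this] show thesis using that by blast
  qed
  \<comment> \<open>Once treated, a closed gap is left untouched by all later stages, so the
    sequence is eventually constant on it and the limit inherits the polynomial.\<close>
  have W_gap: "W n x = poly_rat (p i) x" if "i < n" "x \<in> {A i..B i}" for n i x
    using that(1)
  proof (induction n)
    case (Suc n)
    show ?case
    proof (cases "i = n")
      case True
      then show ?thesis using p(1) that(2) by simp
    next
      case False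
      then have "x \<notin> {\<alpha> n<..<\<beta> n}" using \<alpha>\<beta>(3)[of n] that(2) Suc.prems by fastforce
      then show ?thesis using W_out Suc False by simp
    qed
  qed simp
  have w_gap: "w x = poly_rat (p i) x" if x: "x \<in> {A i..B i}" for i x
  proof -
    have "\<forall>\<^sub>F n in sequentially. W n x = poly_rat (p i) x"
      using eventually_gt_at_top[of i] by eventually_elim (rule W_gap[OF _ x])
    then show ?thesis using w(2)[of x] by (metis LIMSEQ_unique tendsto_eventually)
  qed
  have inj: "inj p"
  proof (rule linorder_injI)
    fix i j :: nat assume "i < j"
    then show "p i \<noteq> p j" using p(2)[of i j] W_gap[OF _ mid, of i j] by auto
  qed
  define q where "q = (\<lambda>g. p (the_inv G g))"
  have inv: "the_inv G (G n) = n" for n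
    using G by (simp add: bij_betw_def the_inv_f_f)
  show ?thesis
  proof (intro exI[of _ w] exI[of _ q] conjI allI impI)
    show "smooth w" by (rule w(1))
  next
    fix x assume x: "x \<le> Inf E \<or> Sup E \<le> x"
    have "W n x = 0" for n
    proof (induction n)
      case (Suc n)
      have "x \<notin> {\<alpha> n<..<\<beta> n}" using \<alpha>\<beta>(3)[of n] x by auto
      then show ?case using Suc W_out by simp
    qed (simp add: W)
    then show "w x = 0" using w(2)[of x] by (simp add: LIMSEQ_const_iff)
  next
    fix j x assume "j \<le> k"
    then show "\<bar>(deriv ^^ j) w x\<bar> \<le> \<eta>" by (rule w(3))
  next
    show "\<forall>(a, b)\<in>gaps. \<forall>x\<in>{a..b}. w x = poly_rat (q (a, b)) x"
    proof clarify
      fix a b x assume "(a, b) \<in> gaps" and x: "x \<in> {a..b}"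
      then obtain n where n: "G n = (a, b)" using G by (metis bij_betw_imp_surj_on imageE)
      then show "w x = poly_rat (q (a, b)) x"
        using w_gap[of x n] x inv[of n] by (simp add: A_def B_def q_def)
    qed
    show "inj_on q gaps"
    proof (rule inj_onI)
      fix g h assume "g \<in> gaps" "h \<in> gaps" "q g = q h"
      moreover from this obtain m n where "G m = g" "G n = h"
        using G by (metis bij_betw_imp_surj_on imageE)
      ultimately show "g = h" using inv inj by (auto simp: q_def dest: injD)
    qed
  qed
qed

end


subsection \<open>Germs of rational functions and Liouville numbers\<close>

abbreviation poly_int :: "int poly \<Rightarrow> 'a::comm_ring_1 \<Rightarrow> 'a" where
  "poly_int p \<equiv> poly (map_poly of_int p)"

lemma poly_int_add [simp]: "poly_int (p + q) z = poly_int p z + poly_int q z"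
  by (rule poly_map_poly_add) simp_all

lemma poly_int_mult [simp]: "poly_int (p * q) z = poly_int p z * poly_int q z"
  by (rule poly_map_poly_mult) simp_all

lemma poly_int_pCons [simp]: "poly_int (pCons a p) z = of_int a + z * poly_int p z"
  by (simp add: map_poly_pCons)

lemma poly_int_diff [simp]: "poly_int (p - q) z = poly_int p z - poly_int q z"
  using poly_int_add[of "p - q" q z] by (simp add: algebra_simps)

lemma poly_int_power [simp]: "poly_int (p ^ n) z = poly_int p z ^ n"
  by (induction n) simp_all

lemma poly_int_of_int [simp]: "poly_int (of_int a) z = of_int a"
  by (simp add: of_int_poly)

lemma poly_int_sum [simp]: "poly_int (\<Sum>i\<in>I. p i) z = (\<Sum>i\<in>I. poly_int (p i) z)"
  by (induction I rule: infinite_finite_induct) simp_all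

lemma DERIV_poly_int: "(poly_int p has_real_derivative poly_int (pderiv p) x) (at x)"
proof -
  have "pderiv (map_poly of_int p) = (map_poly of_int (pderiv p) :: real poly)"
    by (rule poly_eqI) (simp add: coeff_pderiv coeff_map_poly)
  then show ?thesis using poly_DERIV[of "map_poly of_int p" x] by simp
qed

text \<open>The value b^N p(a/b), written without division so that it makes sense in any commutative
  ring. Over \<open>int\<close> it yields numerators and denominators of values at fractions; over
  \<open>int poly\<close> it substitutes one rational function into another.\<close>

definition homogenize :: "nat \<Rightarrow> int poly \<Rightarrow> 'a::comm_ring_1 \<Rightarrow> 'a \<Rightarrow> 'a" where
  "homogenize N p a b = (\<Sum>i\<le>N. of_int (coeff p i) * a ^ i * b ^ (N - i))"

lemma homogenize_eq:
  fixes a b :: "'a::field_char_0"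
  assumes "degree p \<le> N" "b \<noteq> 0"
  shows "homogenize N p a b = b ^ N * poly_int p (a / b)"
proof -
  have "poly_int p (a / b) = (\<Sum>i\<le>degree p. of_int (coeff p i) * (a / b) ^ i)"
    by (simp add: poly_altdef coeff_map_poly degree_map_poly)
  also have "\<dots> = (\<Sum>i\<le>N. of_int (coeff p i) * (a / b) ^ i)"
    using assms(1) by (intro sum.mono_neutral_left) (auto simp: coeff_eq_0)
  finally have "b ^ N * poly_int p (a / b) = (\<Sum>i\<le>N. b ^ N * (of_int (coeff p i) * (a / b) ^ i))"
    by (simp add: sum_distrib_left)
  also have "\<dots> = homogenize N p a b"
    unfolding homogenize_def
  proof (rule sum.cong)
    fix i assume "i \<in> {..N}"
    then have "b ^ N = b ^ (N - i) * b ^ i" by (simp flip: power_add)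
    then show "b ^ N * (of_int (coeff p i) * (a / b) ^ i) = of_int (coeff p i) * a ^ i * b ^ (N - i)"
      using assms(2) by (simp add: power_divide)
  qed simp
  finally show ?thesis ..
qed

lemma of_int_homogenize: "of_int (homogenize N p a b) = homogenize N p (of_int a) (of_int b)"
  by (simp add: homogenize_def)

lemma poly_int_homogenize:
  "poly_int (homogenize N p A B) z = homogenize N p (poly_int A z) (poly_int B z)"
  by (simp add: homogenize_def)

text \<open>Only a neighbourhood of one point is described, since no single rational function
  describes f globally. Integer rather than rational coefficients make the denominators of values at
  fractions explicit.\<close>

definition rational_germ :: "(real \<Rightarrow> real) \<Rightarrow> real \<Rightarrow> bool" where
  "rational_germ g x \<longleftrightarrow> (\<exists>A B. poly_int B x \<noteq> 0 \<and>
     (\<forall>\<^sub>F y in nhds x. g y = poly_int A y / poly_int B y))"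

text \<open>The same \<open>A\<close> and \<open>B\<close> are also read over the complex numbers;
  the behaviour at \<i> is the part that survives composition.\<close>

definition pole_germ :: "(real \<Rightarrow> real) \<Rightarrow> real \<Rightarrow> bool" where
  "pole_germ g x \<longleftrightarrow> (\<exists>A B. poly_int B x \<noteq> 0 \<and>
     (\<forall>\<^sub>F y in nhds x. g y = poly_int A y / poly_int B y) \<and>
     filterlim (\<lambda>z::complex. poly_int A z / poly_int B z) at_infinity (at \<i>))"

lemma pole_germ_imp_rational_germ: "pole_germ g x \<Longrightarrow> rational_germ g x"
  unfolding pole_germ_def rational_germ_def by blast

lemma eventually_poly_int_nonzero:
  fixes x :: real
  assumes "poly_int B x \<noteq> 0"
  shows "\<forall>\<^sub>F y in nhds x. poly_int B y \<noteq> 0"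
proof -
  have "isCont (poly_int B) x" by (rule DERIV_isCont[OF DERIV_poly_int])
  then have "(poly_int B \<longlongrightarrow> poly_int B x) (nhds x)"
    by (simp add: tendsto_at_iff_tendsto_nhds isCont_def)
  then show ?thesis using assms by (rule tendsto_imp_eventually_ne)
qed

lemma rational_germ_DERIV:
  assumes "rational_germ g x"
  shows "\<forall>\<^sub>F y in nhds x. (g has_real_derivative deriv g y) (at y)"
    and "rational_germ (deriv g) x"
proof -
  obtain A B where B: "poly_int B x \<noteq> 0"
    and g: "\<forall>\<^sub>F y in nhds x. g y = poly_int A y / poly_int B y"
    using assms unfolding rational_germ_def by blast
  define A' where "A' = pderiv A * B - A * pderiv B"
  have *: "\<forall>\<^sub>F y in nhds x. (g has_real_derivative poly_int A' y / poly_int (B * B) y) (at y)"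
    \<comment> \<open>Differentiating at \<open>y\<close> requires the quotient formula in a
      neighbourhood of \<open>y\<close>; \<open>eventually_eventually\<close> provides this for all
      \<open>y\<close> near \<open>x\<close>.\<close>
    using eventually_poly_int_nonzero[OF B] eventually_eventually[THEN iffD2, OF g]
  proof eventually_elim
    case (elim y)
    have "((\<lambda>y. poly_int A y / poly_int B y) has_real_derivative
        poly_int A' y / poly_int (B * B) y) (at y)"
      using DERIV_divide[OF DERIV_poly_int[of A y] DERIV_poly_int[of B y]] elim(1)
      by (simp add: A'_def mult_ac)
    then show ?case using elim(2) DERIV_cong_ev[OF refl elim(2) refl] by simp
  qed
  then show "\<forall>\<^sub>F y in nhds x. (g has_real_derivative deriv g y) (at y)"
    by (rule eventually_mono) (simp add: DERIV_imp_deriv)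
  have "\<forall>\<^sub>F y in nhds x. deriv g y = poly_int A' y / poly_int (B * B) y"
    using * by (rule eventually_mono) (rule DERIV_imp_deriv)
  then show "rational_germ (deriv g) x"
    unfolding rational_germ_def by (intro exI[of _ A'] exI[of _ "B * B"]) (use B in simp)
qed

lemma rational_germ_higher_deriv: "rational_germ g x \<Longrightarrow> rational_germ ((deriv ^^ m) g) x"
  by (induction m) (auto intro: rational_germ_DERIV)

lemma rational_germ_isCont: "rational_germ g x \<Longrightarrow> isCont g x"
  using rational_germ_DERIV(1) eventually_nhds_x_imp_x DERIV_isCont by metis

text \<open>Near \<i> the inner quotient tends to infinity and the outer one fixes infinity, so the
  composition has the same behaviour at \<i>. Homogenizing both outer polynomials to the common
  degree \<open>N\<close> makes the powers of \<open>B\<close> cancel.\<close>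

lemma pole_germ_compose:
  assumes g: "pole_germ g x" and V: "poly_int V (g x) \<noteq> 0"
    and f: "\<forall>\<^sub>F y in nhds (g x). f y = poly_int U y / poly_int V y"
    and inf: "filterlim (\<lambda>z::complex. poly_int U z / poly_int V z) at_infinity at_infinity"
  shows "pole_germ (f \<circ> g) x"
proof -
  obtain A B where B: "poly_int B x \<noteq> 0"
    and gAB: "\<forall>\<^sub>F y in nhds x. g y = poly_int A y / poly_int B y"
    and pole: "filterlim (\<lambda>z::complex. poly_int A z / poly_int B z) at_infinity (at \<i>)"
    using g unfolding pole_germ_def by blast
  define N where "N = max (degree U) (degree V)"
  define U' V' where "U' = homogenize N U A B" and "V' = homogenize N V A B"
  have U': "poly_int U' z = poly_int B z ^ N * poly_int U (poly_int A z / poly_int B z)"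
    and V': "poly_int V' z = poly_int B z ^ N * poly_int V (poly_int A z / poly_int B z)"
    if "poly_int B z \<noteq> 0" for z :: "'a::field_char_0"
    using that by (simp_all add: U'_def V'_def poly_int_homogenize homogenize_eq N_def)
  have quot: "poly_int U' z / poly_int V' z =
      poly_int U (poly_int A z / poly_int B z) / poly_int V (poly_int A z / poly_int B z)"
    if "poly_int B z \<noteq> 0" for z :: "'a::field_char_0"
    using that by (simp add: U' V')
  show ?thesis
    unfolding pole_germ_def
  proof (rule exI[of _ U'], rule exI[of _ V'], intro conjI)
    show "poly_int V' x \<noteq> 0"
      using V'[OF B] V B eventually_nhds_x_imp_x[OF gAB] by simp
    have "(g \<longlongrightarrow> g x) (nhds x)"
      using rational_germ_isCont[OF pole_germ_imp_rational_germ[OF g]]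
      by (simp add: tendsto_at_iff_tendsto_nhds isCont_def)
    then have "\<forall>\<^sub>F y in nhds x. f (g y) = poly_int U (g y) / poly_int V (g y)"
      using f by (rule eventually_compose_filterlim[rotated])
    then show "\<forall>\<^sub>F y in nhds x. (f \<circ> g) y = poly_int U' y / poly_int V' y"
      using gAB eventually_poly_int_nonzero[OF B]
      by eventually_elim (simp add: quot)
    \<comment> \<open>Division by zero yields 0, so a nonzero quotient certifies that
      \<open>B\<close> does not vanish at z.\<close>
    have "\<forall>\<^sub>F z in at \<i>. (poly_int A z / poly_int B z :: complex) \<noteq> 0"
      using pole by (rule filterlim_at_infinity_imp_eventually_ne)
    then have ev: "\<forall>\<^sub>F z in at \<i>. (poly_int U (poly_int A z / poly_int B z) /
        poly_int V (poly_int A z / poly_int B z) :: complex) = poly_int U' z / poly_int V' z"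
      by (rule eventually_mono) (simp add: quot)
    show "filterlim (\<lambda>z::complex. poly_int U' z / poly_int V' z) at_infinity (at \<i>)"
      using filterlim_compose[OF inf pole] iffD1[OF filterlim_cong[OF refl refl ev]] by blast
  qed
qed

lemma poly_germ_of_const_higher_deriv:
  assumes "rational_germ g x" "\<forall>\<^sub>F y in nhds x. (deriv ^^ m) g y = c"
  shows "\<exists>p. \<forall>\<^sub>F y in nhds x. g y = poly p y"
  using assms
proof (induction m arbitrary: g)
  case 0
  then show ?case by (intro exI[of _ "[:c:]"]) simp
next
  case (Suc m)
  obtain q where q: "\<forall>\<^sub>F y in nhds x. deriv g y = poly q y"
    using Suc.IH[OF rational_germ_DERIV(2)[OF Suc.prems(1)]] Suc.prems(2)
    by (auto simp: funpow_deriv_Suc simp del: funpow.simps)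
  obtain p where p: "pderiv p = q" using ex_pderiv_eq by blast
  have "\<forall>\<^sub>F y in nhds x. ((\<lambda>y. g y - poly p y) has_real_derivative 0) (at y)"
    using rational_germ_DERIV(1)[OF Suc.prems(1)] q
  proof eventually_elim
    case (elim y)
    then show ?case using DERIV_diff[OF elim(1) poly_DERIV[of p y]] p by simp
  qed
  then obtain r where r: "r > 0"
      "\<And>y. dist y x < r \<Longrightarrow> ((\<lambda>y. g y - poly p y) has_real_derivative 0) (at y)"
    unfolding eventually_nhds_metric by blast
  have "\<exists>c. \<forall>y\<in>ball x r. g y - poly p y = c"
  proof (rule has_field_derivative_zero_constant)
    show "((\<lambda>y. g y - poly p y) has_real_derivative 0) (at y within ball x r)" if "y \<in> ball x r" for y
      using r(2)[of y] that by (auto simp: dist_commute intro: has_field_derivative_at_within)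
  qed simp
  then obtain c where "\<And>y. y \<in> ball x r \<Longrightarrow> g y = poly (p + [:c:]) y"
    by (auto simp: algebra_simps)
  moreover have "\<forall>\<^sub>F y in nhds x. y \<in> ball x r" by (rule eventually_nhds_ball) (rule r)
  ultimately show ?case
    by (intro exI[of _ "p + [:c:]"]) (auto elim: eventually_mono)
qed

lemma infinite_eventually_nhds:
  fixes x :: real
  assumes "\<forall>\<^sub>F y in nhds x. P y"
  shows "infinite {y. P y}"
proof
  assume fin: "finite {y. P y}"
  obtain r where r: "r > 0" "\<And>y. dist y x < r \<Longrightarrow> P y"
    using assms unfolding eventually_nhds_metric by blast
  have "{x<..<x + r} \<subseteq> {y. P y}" using r by (auto simp: dist_real_def)
  then show False using fin r(1) infinite_Ioo[of x "x + r"] finite_subset[of "{x<..<x + r}" "{y. P y}"] by auto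
qed

text \<open>A constant derivative makes the germ a polynomial after repeated integration, and a
  polynomial is bounded near \<i>.\<close>

lemma pole_germ_higher_deriv_not_const:
  assumes "pole_germ g x"
  shows "\<not> (\<forall>\<^sub>F y in nhds x. (deriv ^^ m) g y = c)"
proof
  assume "\<forall>\<^sub>F y in nhds x. (deriv ^^ m) g y = c"
  from poly_germ_of_const_higher_deriv[OF pole_germ_imp_rational_germ[OF assms] this]
  obtain p where p: "\<forall>\<^sub>F y in nhds x. g y = poly p y" by blast
  obtain A B where B: "poly_int B x \<noteq> 0"
    and g: "\<forall>\<^sub>F y in nhds x. g y = poly_int A y / poly_int B y"
    and pole: "filterlim (\<lambda>z::complex. poly_int A z / poly_int B z) at_infinity (at \<i>)"
    using assms unfolding pole_germ_def by blast
  define D where "D = map_poly of_int A - p * map_poly of_int B"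
  have "\<forall>\<^sub>F y in nhds x. poly D y = 0"
    using p g eventually_poly_int_nonzero[OF B]
    by eventually_elim (simp add: D_def divide_simps)
  then have "D = 0" using infinite_eventually_nhds poly_roots_finite by blast
  then have eq: "map_poly of_int A = p * map_poly of_int B" by (simp add: D_def)
  \<comment> \<open>The identity A = p B holds near \<open>x\<close>, hence between polynomials, and
    can be read over the complex numbers. The coefficients of \<open>p\<close> are merely real, as
    integration constants are.\<close>
  define P where "P = map_poly complex_of_real p"
  have lift: "map_poly complex_of_real (map_poly of_int C) = map_poly of_int C" for C
    by (rule poly_eqI) (simp add: coeff_map_poly)
  have A: "poly_int A z = poly P z * poly_int B z" for z :: complex
    unfolding lift[symmetric] eq P_def by (rule poly_map_poly_mult) simp_all
  have "\<forall>\<^sub>F z in at \<i>. (poly_int A z / poly_int B z :: complex) \<noteq> 0"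
    using pole by (rule filterlim_at_infinity_imp_eventually_ne)
  then have ev: "\<forall>\<^sub>F z in at \<i>. poly_int A z / poly_int B z = poly P z"
    by (rule eventually_mono) (auto simp: A)
  have "filterlim (poly P) at_infinity (at \<i>)"
    by (rule iffD1[OF filterlim_cong[OF refl refl ev] pole])
  moreover have "(poly P \<longlongrightarrow> poly P \<i>) (at \<i>)"
    by (intro tendsto_poly tendsto_ident_at)
  ultimately show False
    using not_tendsto_and_filterlim_at_infinity trivial_limit_at by blast
qed

text \<open>Maillet's argument: a rational approximation \<open>p/q\<close> of \<open>\<xi>\<close> is mapped to a rational
  approximation of \<open>g \<xi>\<close> whose denominator is at most a constant times a fixed power of \<open>q\<close>.\<close>

lemma rational_germ_liouville:
  assumes g: "rational_germ g \<xi>" and \<xi>: "\<xi> \<in> liouville_numbers"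
    and nc: "\<not> (\<forall>\<^sub>F y in nhds \<xi>. g y = g \<xi>)"
  shows "g \<xi> \<in> liouville_numbers"
  unfolding liouville_numbers_def
proof (clarify)
  fix N :: nat assume "N \<ge> 1"
  obtain A B where B: "poly_int B \<xi> \<noteq> 0"
    and gAB: "\<forall>\<^sub>F y in nhds \<xi>. g y = poly_int A y / poly_int B y"
    using g unfolding rational_germ_def by blast
  \<comment> \<open>Near \<xi> the roots of \<open>D\<close> are the points where \<open>g\<close>
    takes the value at \<xi>. As \<open>g\<close> is not locally constant, \<open>D\<close> is
    nonzero, so its finitely many roots are avoided close to \<xi>.\<close>
  define D where "D = map_poly of_int A - smult (g \<xi>) (map_poly of_int B)"
  have D: "\<forall>\<^sub>F y in nhds \<xi>. poly D y = 0 \<longleftrightarrow> g y = g \<xi>"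
    using gAB eventually_poly_int_nonzero[OF B]
    by eventually_elim (auto simp: D_def nonzero_divide_eq_eq)
  have at: "\<forall>\<^sub>F y in at \<xi>. P y" if "\<forall>\<^sub>F y in nhds \<xi>. P y" for P
    using that by (simp add: eventually_nhds_conv_at)
  have "D \<noteq> 0"
    using D nc by (auto elim!: eventually_mono)
  then have "finite {y. poly D y = 0}" by (rule poly_roots_finite)
  then have "\<forall>\<^sub>F y in at \<xi>. y \<notin> {y. poly D y = 0}"
    using islimpt_finite islimpt_iff_eventually by blast
  then have ne: "\<forall>\<^sub>F y in at \<xi>. g y \<noteq> g \<xi>"
    using at[OF D] by eventually_elim simp
  define M where "M = \<bar>poly_int B \<xi>\<bar> + 1"
  have M: "M \<ge> 1" by (simp add: M_def)
  have "((\<lambda>y. \<bar>poly_int B y\<bar>) \<longlongrightarrow> \<bar>poly_int B \<xi>\<bar>) (at \<xi>)"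
    by (intro tendsto_rabs tendsto_poly tendsto_ident_at)
  from order_tendstoD(2)[OF this, of M]
  have bM: "\<forall>\<^sub>F y in at \<xi>. \<bar>poly_int B y\<bar> \<le> M"
    by (simp add: M_def) (auto elim: eventually_mono)
  have "(g has_real_derivative deriv g \<xi>) (at \<xi>)"
    using rational_germ_DERIV(1)[OF g] by (rule eventually_nhds_x_imp_x)
  then have "((\<lambda>y. \<bar>(g y - g \<xi>) / (y - \<xi>)\<bar>) \<longlongrightarrow> \<bar>deriv g \<xi>\<bar>) (at \<xi>)"
    by (intro tendsto_rabs) (simp add: has_field_derivative_iff)
  define L where "L = \<bar>deriv g \<xi>\<bar> + 1"
  from order_tendstoD(2)[OF \<open>((\<lambda>y. \<bar>(g y - g \<xi>) / (y - \<xi>)\<bar>) \<longlongrightarrow> _) _\<close>, of L]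
  have "\<forall>\<^sub>F y in at \<xi>. \<bar>(g y - g \<xi>) / (y - \<xi>)\<bar> < L" by (simp add: L_def)
  moreover have "\<forall>\<^sub>F y in at \<xi>. y \<noteq> \<xi>" by (simp add: eventually_at_filter)
  ultimately have L: "\<forall>\<^sub>F y in at \<xi>. \<bar>g y - g \<xi>\<bar> \<le> L * \<bar>y - \<xi>\<bar>"
    by eventually_elim (simp add: abs_divide pos_divide_less_eq less_imp_le)
  have Lpos: "L \<ge> 1" by (simp add: L_def)
  have "\<forall>\<^sub>F y in at \<xi>. g y = poly_int A y / poly_int B y \<and> poly_int B y \<noteq> 0 \<and> g y \<noteq> g \<xi> \<and>
      \<bar>poly_int B y\<bar> \<le> M \<and> \<bar>g y - g \<xi>\<bar> \<le> L * \<bar>y - \<xi>\<bar>"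
    using at[OF gAB] at[OF eventually_poly_int_nonzero[OF B]] ne bM L
    by eventually_elim blast
  then obtain \<delta> where \<delta>: "\<delta> > 0" and near: "\<And>y. 0 < \<bar>y - \<xi>\<bar> \<Longrightarrow> \<bar>y - \<xi>\<bar> < \<delta> \<Longrightarrow>
      g y = poly_int A y / poly_int B y \<and> poly_int B y \<noteq> 0 \<and> g y \<noteq> g \<xi> \<and>
      \<bar>poly_int B y\<bar> \<le> M \<and> \<bar>g y - g \<xi>\<bar> \<le> L * \<bar>y - \<xi>\<bar>"
    unfolding eventually_at by (auto simp: dist_real_def)
  define d where "d = max (degree A) (degree B)"
  obtain e where e: "max (1 / \<delta>) (L * (2 * M) ^ N) < 2 ^ e"
    using real_arch_pow[of 2 "max (1 / \<delta>) (L * (2 * M) ^ N)"] by auto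
  \<comment> \<open>The denominator of the value at p/q is at most 2 M q^d, and its N-th power
    consumes q^(d N). The remaining factor is at least 2^e and absorbs both the constant L (2M)^N
    and 1/\<delta>. The successor ensures K \<ge> 1.\<close>
  define K where "K = d * N + Suc e"
  obtain p q :: int where q: "q \<ge> 2" and pq: "0 < \<bar>\<xi> - of_int p / of_int q\<bar>"
      "\<bar>\<xi> - of_int p / of_int q\<bar> < 1 / of_int q ^ K"
  proof -
    have "K \<ge> 1" by (simp add: K_def)
    then show thesis using \<xi> that unfolding liouville_numbers_def by blast
  qed
  define y where "y = real_of_int p / of_int q"
  have q2: "real_of_int q \<ge> 2" using q by linarith
  have qe: "2 ^ e \<le> real_of_int q ^ Suc e"
  proof -
    have "(2::real) ^ e \<le> 2 ^ Suc e" by simp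
    also have "\<dots> \<le> real_of_int q ^ Suc e" by (rule power_mono) (use q2 in auto)
    finally show ?thesis .
  qed
  have qK: "real_of_int q ^ K = real_of_int q ^ (d * N) * real_of_int q ^ Suc e"
    by (simp add: K_def power_add)
  have q1: "1 \<le> real_of_int q ^ (d * N)" using q2 by (intro one_le_power) auto
  have "1 / \<delta> < real_of_int q ^ K"
  proof -
    have "1 / \<delta> < 1 * 2 ^ e" using e by simp
    also have "\<dots> \<le> real_of_int q ^ K" unfolding qK by (rule mult_mono) (use q1 qe in auto)
    finally show ?thesis .
  qed
  then have "1 / real_of_int q ^ K < \<delta>" using \<delta> q2 by (simp add: field_simps)
  then have y: "0 < \<bar>y - \<xi>\<bar>" "\<bar>y - \<xi>\<bar> < \<delta>" and yK: "\<bar>y - \<xi>\<bar> < 1 / real_of_int q ^ K"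
    using pq by (auto simp: y_def abs_minus_commute)
  note Y = near[OF y]
  define P Q where "P = homogenize d A p q" and "Q = homogenize d B p q"
  have PQ: "real_of_int P = of_int q ^ d * poly_int A y" "real_of_int Q = of_int q ^ d * poly_int B y"
    using q by (simp_all add: P_def Q_def of_int_homogenize homogenize_eq d_def y_def)
  have Q0: "Q \<noteq> 0"
  proof
    assume "Q = 0"
    then show False using PQ(2) Y q by simp
  qed
  \<comment> \<open>The fraction is expanded by 2 and its sign moved to the numerator, so that the
    denominator is at least 2 as the definition of Liouville numbers demands.\<close>
  define P' Q' where "P' = 2 * P * sgn Q" and "Q' = 2 * \<bar>Q\<bar>"
  have Q'2: "Q' \<ge> 2" using Q0 by (simp add: Q'_def)
  have gy: "of_int P' / of_int Q' = g y"
  proof -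
    have "real_of_int P' / of_int Q' = of_int P / of_int Q"
      using Q0 by (auto simp: P'_def Q'_def sgn_if abs_if)
    also have "\<dots> = g y" using PQ Y q by simp
    finally show ?thesis .
  qed
  have "\<bar>real_of_int Q\<bar> \<le> of_int q ^ d * M"
    unfolding PQ abs_mult using Y q2 by (intro mult_mono) auto
  then have "real_of_int Q' \<le> 2 * M * of_int q ^ d" by (simp add: Q'_def mult_ac)
  then have "real_of_int Q' ^ N \<le> (2 * M * of_int q ^ d) ^ N"
    using Q'2 by (intro power_mono) auto
  then have "L * real_of_int Q' ^ N \<le> L * (2 * M * of_int q ^ d) ^ N"
    using Lpos by (intro mult_left_mono) auto
  also have "\<dots> = L * ((2 * M) ^ N * of_int q ^ (d * N))"
    by (simp only: power_mult_distrib[of "2 * M"] power_mult)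
  also have "\<dots> = of_int q ^ (d * N) * (L * (2 * M) ^ N)"
    by (simp only: mult_ac)
  also have "\<dots> \<le> real_of_int q ^ K"
    unfolding qK using e qe q1 by (intro mult_left_mono) auto
  finally have bound: "L * real_of_int Q' ^ N \<le> real_of_int q ^ K" .
  have "\<bar>g y - g \<xi>\<bar> \<le> L * \<bar>y - \<xi>\<bar>" using Y by blast
  also have "\<dots> < L * (1 / real_of_int q ^ K)" using yK Lpos by (intro mult_strict_left_mono) auto
  also have "\<dots> \<le> 1 / real_of_int Q' ^ N"
    using bound Q'2 q2 by (simp add: field_simps)
  finally have "\<bar>g \<xi> - of_int P' / of_int Q'\<bar> < 1 / of_int Q' ^ N"
    by (simp add: gy abs_minus_commute)
  moreover have "0 < \<bar>g \<xi> - of_int P' / of_int Q'\<bar>" using Y by (simp add: gy)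
  ultimately show "\<exists>p q. 2 \<le> q \<and> 0 < \<bar>g \<xi> - real_of_int p / real_of_int q\<bar> \<and>
      \<bar>g \<xi> - real_of_int p / real_of_int q\<bar> < 1 / real_of_int q ^ N"
    using Q'2 by blast
qed

section \<open>Number fields\<close>

lemma rational_germ_number_field:
  assumes K: "real_number_field K" and x: "x \<in> K" and g: "rational_germ g x"
  shows "g x \<in> K"
proof -
  have cl: "0 \<in> K" "1 \<in> K" "\<And>x y. x \<in> K \<Longrightarrow> y \<in> K \<Longrightarrow> x + y \<in> K"
      "\<And>x y. x \<in> K \<Longrightarrow> y \<in> K \<Longrightarrow> x * y \<in> K" "\<And>x. x \<in> K \<Longrightarrow> - x \<in> K"
      "\<And>x. x \<in> K \<Longrightarrow> inverse x \<in> K"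
    using K unfolding real_number_field_def by blast+
  have nat: "real n \<in> K" for n by (induction n) (auto intro: cl)
  have int: "real_of_int i \<in> K" for i
    using nat[of "nat i"] cl(5)[OF nat[of "nat (- i)"]] by (cases "i \<ge> 0") auto
  have poly: "poly_int A x \<in> K" for A
    by (induction A) (auto intro: cl int x)
  obtain A B where "g x = poly_int A x / poly_int B x"
    using g eventually_nhds_x_imp_x unfolding rational_germ_def by blast
  then show ?thesis using cl(4)[OF poly cl(6)[OF poly]] by (simp add: divide_inverse)
qed

lemma number_field_algebraic:
  assumes "real_number_field K" "x \<in> K"
  shows "algebraic x"
proof -
  obtain S where S: "finite S" "K = rat_real.span S"
    and one: "1 \<in> K" and mult: "\<And>y. y \<in> K \<Longrightarrow> x * y \<in> K"
    using assms unfolding real_number_field_def by blast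
  have pow: "x ^ i \<in> K" for i by (induction i) (auto intro: one mult)
  define T where "T = (\<lambda>i. x ^ i) ` {..card S}"
  have poly: "algebraic x"
    if fin: "finite I" and nz: "\<exists>i\<in>I. c i \<noteq> 0" and zero: "(\<Sum>i\<in>I. of_rat (c i) * x ^ i) = 0"
    for I :: "nat set" and c :: "nat \<Rightarrow> rat"
  proof -
    define p where "p = (\<Sum>i\<in>I. monom (real_of_rat (c i)) i)"
    have co: "coeff p j = (if j \<in> I then of_rat (c j) else 0)" for j
      using fin by (simp add: p_def coeff_sum)
    show ?thesis
      unfolding algebraic_altdef
    proof (intro exI[of _ p] conjI allI)
      show "coeff p i \<in> \<rat>" for i by (simp add: co)
      obtain i where "i \<in> I" "c i \<noteq> 0" using nz by blast
      then have "coeff p i \<noteq> 0" by (simp add: co)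
      then show "p \<noteq> 0" by auto
      show "poly p x = 0" using zero by (simp add: p_def poly_sum poly_monom)
    qed
  qed
  show ?thesis
  \<comment> \<open>Linear dependence concerns sets: if two of the powers coincide, the set of
    powers is too small for the dimension count, but their difference is already a relation.\<close>
  proof (cases "inj_on (\<lambda>i. x ^ i) {..card S}")
    case False
    then obtain i j where ij: "i \<noteq> j" "x ^ i = x ^ j" by (auto simp: inj_on_def)
    then show ?thesis
      by (intro poly[of "{i, j}" "\<lambda>k. if k = i then 1 else - 1"]) auto
  next
    case True
    have "card T = Suc (card S)" unfolding T_def by (simp add: card_image[OF True])
    moreover have "T \<subseteq> rat_real.span S" using pow S(2) by (auto simp: T_def)
    ultimately have "rat_real.dependent T"
      using rat_real.independent_span_bound[OF S(1), of T] by auto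
    then obtain u where u: "\<exists>v\<in>T. u v \<noteq> 0" "(\<Sum>v\<in>T. of_rat (u v) * v) = 0"
      using rat_real.dependent_finite[of T] by (auto simp: T_def)
    have "(\<Sum>i\<le>card S. of_rat (u (x ^ i)) * x ^ i) = 0"
      using u(2) unfolding T_def by (simp add: sum.reindex[OF True])
    moreover have "\<exists>i\<in>{..card S}. u (x ^ i) \<noteq> 0" using u(1) by (auto simp: T_def)
    ultimately show ?thesis by (intro poly[of "{..card S}" "\<lambda>i. u (x ^ i)"]) auto
  qed
qed


subsection \<open>The rational branches\<close>

text \<open>Polymorphic, so that real values and complex poles refer to the same expression. At \<i>
  and -\<i> the second summand is 0 by convention; poles are therefore studied on punctured
  neighbourhoods.\<close>

definition branch :: "rat poly \<Rightarrow> rat \<Rightarrow> 'a::field_char_0 \<Rightarrow> 'a" where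
  "branch s r z = poly_rat s z + of_rat r / (1 + z\<^sup>2)"

lemma poly_rat_inject:
  fixes A :: "'a::field_char_0 set"
  assumes "infinite A" "\<And>x. x \<in> A \<Longrightarrow> poly_rat s x = poly_rat t x"
  shows "s = t"
proof -
  have "map_poly of_rat s = (map_poly of_rat t :: 'a poly)"
  proof (rule ccontr)
    assume "map_poly of_rat s \<noteq> (map_poly of_rat t :: 'a poly)"
    then have "finite {x::'a. poly (map_poly of_rat s - map_poly of_rat t) x = 0}"
      by (intro poly_roots_finite) simp
    moreover have "A \<subseteq> {x. poly (map_poly of_rat s - map_poly of_rat t) x = 0}"
      using assms(2) by auto
    ultimately show False using assms(1) finite_subset by blast
  qed
  then have "of_rat (coeff s n) = (of_rat (coeff t n) :: 'a)" for n
    by (metis coeff_map_poly of_rat_0)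
  then show ?thesis by (intro poly_eqI) simp
qed

definition branch_fract :: "rat poly \<Rightarrow> rat \<Rightarrow> rat poly fract" where
  "branch_fract s r = Fract (s * [:1, 0, 1:] + [:r:]) [:1, 0, 1:]"

text \<open>The representation chosen by \<open>quot_of_fract\<close> need not be computed: by
  coprimality its denominator divides 1 + X^2, so it does not vanish at \<open>z\<close>, and
  cross-multiplication gives the value.\<close>

lemma ratfun_eval_branch:
  assumes z: "1 + z\<^sup>2 \<noteq> 0"
  shows "ratfun_eval (branch_fract s r) z = branch s r z"
proof -
  define R where "R = branch_fract s r"
  define den num where "den = ([:1, 0, 1:] :: rat poly)" and "num = s * den + [:r:]"
  obtain A B where AB: "quot_of_fract R = (A, B)" by (cases "quot_of_fract R")
  have B: "B \<noteq> 0" and cop: "coprime A B"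
    using snd_quot_of_fract_nonzero[of R] coprime_quot_of_fract[of R] by (simp_all add: AB)
  have "Fract A B = R" using Fract_quot_of_fract[of R] by (simp add: AB)
  also have "\<dots> = Fract num den" by (simp only: R_def branch_fract_def num_def den_def)
  finally have "Fract A B = Fract num den" .
  then have eq: "A * den = num * B"
    using B by (simp add: eq_fract den_def)
  have "B dvd A * den" unfolding eq by simp
  then have "B dvd den" using cop by (simp add: coprime_commute coprime_dvd_mult_right_iff)
  then obtain t where t: "den = B * t" by (rule dvdE)
  have den: "poly_rat den z = 1 + z\<^sup>2" by (simp add: den_def power2_eq_square)
  have "poly_rat B z \<noteq> 0" using z den t by auto
  moreover have "poly_rat A z * (1 + z\<^sup>2) = (poly_rat s z * (1 + z\<^sup>2) + of_rat r) * poly_rat B z"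
    using arg_cong[OF eq, of "\<lambda>p. poly_rat p z"] by (simp add: num_def den)
  ultimately show ?thesis
    using z AB by (simp add: ratfun_eval_def R_def branch_def field_simps)
qed

lemma one_plus_square_eq_0_iff: "1 + z\<^sup>2 = 0 \<longleftrightarrow> z = \<i> \<or> z = - \<i>" for z :: complex
proof -
  have "1 + z\<^sup>2 = (z - \<i>) * (z + \<i>)" by (simp add: algebra_simps power2_eq_square)
  then show ?thesis by (simp add: eq_neg_iff_add_eq_0)
qed

lemma eventually_one_plus_square_nonzero: "\<forall>\<^sub>F z in at w. 1 + z\<^sup>2 \<noteq> (0::complex)"
proof -
  have "finite {\<i>, - \<i>}" by simp
  then have "\<forall>\<^sub>F z in at w. z \<notin> {\<i>, - \<i>}"
    using islimpt_finite islimpt_iff_eventually by blast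
  then show ?thesis by (rule eventually_mono) (simp add: one_plus_square_eq_0_iff)
qed

lemma branch_pole:
  assumes r: "r \<noteq> 0" and w: "w \<in> {\<i>, - \<i>}"
  shows "filterlim (branch s r :: complex \<Rightarrow> complex) at_infinity (at w)"
  unfolding branch_def
proof (rule tendsto_add_filterlim_at_infinity)
  show "(poly_rat s \<longlongrightarrow> poly_rat s w) (at w)" by (intro tendsto_poly tendsto_ident_at)
  have "1 + w\<^sup>2 = 0" using w by auto
  moreover have "((\<lambda>z. 1 + z\<^sup>2) \<longlongrightarrow> 1 + w\<^sup>2) (at w)" by (intro tendsto_intros)
  ultimately have "filterlim (\<lambda>z::complex. 1 + z\<^sup>2) (at 0) (at w)"
    using eventually_one_plus_square_nonzero by (intro filterlim_atI) auto
  then show "filterlim (\<lambda>z::complex. of_rat r / (1 + z\<^sup>2)) at_infinity (at w)"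
    by (intro filterlim_divide_at_infinity[OF tendsto_const]) (use r in auto)
qed

lemma branch_at_infinity:
  assumes "degree s > 0"
  shows "filterlim (branch s r :: complex \<Rightarrow> complex) at_infinity at_infinity"
proof -
  have "filterlim (poly_rat s :: complex \<Rightarrow> complex) at_infinity at_infinity"
    by (rule filterlim_poly_at_infinity) (use assms in \<open>simp add: degree_map_poly\<close>)
  moreover have "((\<lambda>z::complex. poly [:of_rat r:] z / poly [:1, 0, 1:] z) \<longlongrightarrow> 0) at_infinity"
    by (rule poly_divide_tendsto_0_at_infinity) simp
  ultimately have "filterlim (\<lambda>z::complex. poly_rat s z + poly [:of_rat r:] z / poly [:1, 0, 1:] z)
      at_infinity at_infinity"
    by (rule tendsto_add_filterlim_at_infinity')
  then show ?thesis by (simp add: branch_def[abs_def] power2_eq_square)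
qed

lemma ratfun_branch_exists:
  assumes r: "r \<noteq> 0" and s: "degree s > 0"
  shows "\<exists>R :: rat poly fract. (\<forall>x::real. branch s r x = ratfun_eval R x) \<and>
    {z::complex. is_pole (ratfun_eval R) z} = {\<i>, - \<i>} \<and>
    filterlim (ratfun_eval R :: complex \<Rightarrow> complex) at_infinity at_infinity"
proof -
  define R where "R = branch_fract s r"
  have at: "\<forall>\<^sub>F z in at w. ratfun_eval R z = branch s r z" for w :: complex
    using eventually_one_plus_square_nonzero
    by (rule eventually_mono) (simp add: R_def ratfun_eval_branch)
  have pole: "is_pole (ratfun_eval R) w \<longleftrightarrow> filterlim (branch s r) at_infinity (at w)" for w :: complex
    unfolding is_pole_def by (rule filterlim_cong[OF refl refl at])
  show ?thesis
  proof (intro exI[of _ R] conjI allI)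
    fix x :: real
    have "1 + x\<^sup>2 > 0" by (simp add: add_pos_nonneg)
    then show "branch s r x = ratfun_eval R x" by (simp add: R_def ratfun_eval_branch)
  next
    have "\<not> filterlim (branch s r) at_infinity (at w)" if "w \<notin> {\<i>, - \<i>}" for w :: complex
    proof
      assume *: "filterlim (branch s r) at_infinity (at w)"
      have "1 + w\<^sup>2 \<noteq> 0" using that by (simp add: one_plus_square_eq_0_iff)
      then have "(branch s r \<longlongrightarrow> branch s r w) (at w)"
        unfolding branch_def[abs_def] by (intro tendsto_intros) auto
      then show False using * not_tendsto_and_filterlim_at_infinity trivial_limit_at by blast
    qed
    then show "{z::complex. is_pole (ratfun_eval R) z} = {\<i>, - \<i>}"
      using branch_pole[OF r] by (auto simp: pole)
    have "\<forall>\<^sub>F z::complex in at_infinity. z \<notin> {\<i>, - \<i>}"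
      by (auto intro!: eventually_conj eventually_not_equal_at_infinity)
    then have ev: "\<forall>\<^sub>F z::complex in at_infinity. ratfun_eval R z = branch s r z"
      by (rule eventually_mono) (simp add: R_def ratfun_eval_branch one_plus_square_eq_0_iff)
    show "filterlim (ratfun_eval R :: complex \<Rightarrow> complex) at_infinity at_infinity"
      by (rule iffD2[OF filterlim_cong[OF refl refl ev] branch_at_infinity[OF s]])
  qed
qed

lemma ex_poly_int_multiple:
  "\<exists>d t. d > 0 \<and> (\<forall>z::real. poly_int t z = of_int d * poly_rat s z) \<and>
     (\<forall>z::complex. poly_int t z = of_int d * poly_rat s z)"
proof (induction s)
  case 0
  show ?case by (intro exI[of _ 1] exI[of _ 0]) simp
next
  case (pCons a s)
  then obtain d t where dt: "d > 0" "\<And>z::real. poly_int t z = of_int d * poly_rat s z"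
      "\<And>z::complex. poly_int t z = of_int d * poly_rat s z" by blast
  obtain m n where mn: "quotient_of a = (m, n)" by fastforce
  then have n: "n > 0" "a = of_int m / of_int n"
    by (simp_all add: quotient_of_denom_pos quotient_of_div)
  show ?case
    by (intro exI[of _ "d * n"] exI[of _ "pCons (d * m) (smult n t)"])
      (use dt n in \<open>auto simp: map_poly_smult of_rat_divide algebra_simps\<close>)
qed

lemma branch_eq_common_denominator:
  fixes z :: "'a::field_char_0"
  assumes "1 + z\<^sup>2 \<noteq> 0" "d > 0" "n > 0" "r = of_int m / of_int n" "poly_int t z = of_int d * poly_rat s z"
  shows "branch s r z = poly_int (of_int n * t * [:1, 0, 1:] + of_int (d * m)) z /
    poly_int (of_int (d * n) * [:1, 0, 1:]) z"
proof -
  define w where "w = 1 + z\<^sup>2"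
  have w: "w \<noteq> 0" "poly_int [:1, 0, 1:] z = w" using assms(1) by (simp_all add: w_def power2_eq_square)
  have num: "poly_int (of_int n * t * [:1, 0, 1:] + of_int (d * m)) z =
      of_int n * (of_int d * poly_rat s z) * w + of_int d * of_int m"
    by (simp only: poly_int_add poly_int_mult poly_int_of_int w assms(5) of_int_mult)
  have den: "poly_int (of_int (d * n) * [:1, 0, 1:]) z = of_int d * of_int n * w"
    by (simp only: poly_int_mult poly_int_of_int w of_int_mult)
  have val: "branch s r z = poly_rat s z + of_int m / of_int n / w"
    by (simp add: branch_def w_def assms(4) of_rat_divide)
  show ?thesis unfolding num den val using assms(2,3) w(1) by (simp add: field_simps)
qed

lemma branch_eq_quotient:
  "\<exists>U V. (\<forall>x::real. poly_int V x \<noteq> 0) \<and>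
    (\<forall>x::real. branch s r x = poly_int U x / poly_int V x) \<and>
    (\<forall>z::complex. 1 + z\<^sup>2 \<noteq> 0 \<longrightarrow> branch s r z = poly_int U z / poly_int V z)"
proof -
  obtain d t where dt: "d > 0" "\<And>z::real. poly_int t z = of_int d * poly_rat s z"
      "\<And>z::complex. poly_int t z = of_int d * poly_rat s z"
    using ex_poly_int_multiple by blast
  obtain m n where mn: "quotient_of r = (m, n)" by fastforce
  then have n: "n > 0" "r = of_int m / of_int n"
    by (simp_all add: quotient_of_denom_pos quotient_of_div)
  have pos: "1 + x\<^sup>2 \<noteq> 0" for x :: real
    using zero_le_power2[of x] by linarith
  show ?thesis
  proof (rule exI[of _ "of_int n * t * [:1, 0, 1:] + of_int (d * m)"],
      rule exI[of _ "of_int (d * n) * [:1, 0, 1:]"], intro conjI allI impI)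
    show "poly_int (of_int (d * n) * [:1, 0, 1:]) x \<noteq> 0" for x :: real
    proof -
      have "poly_int (of_int (d * n) * [:1, 0, 1:]) x = of_int (d * n) * (1 + x\<^sup>2)"
        by (simp only: poly_int_mult poly_int_of_int) (simp add: power2_eq_square)
      then show ?thesis using pos[of x] dt(1) n(1) by simp
    qed
  qed (rule branch_eq_common_denominator dt n pos | assumption)+
qed

lemma pole_germ_branch:
  assumes r: "r \<noteq> 0" and f: "\<forall>\<^sub>F y in nhds x. f y = branch s r y"
  shows "pole_germ f x"
proof -
  obtain U V where UV: "\<And>x::real. poly_int V x \<noteq> 0"
      "\<And>x::real. branch s r x = poly_int U x / poly_int V x"
      "\<And>z::complex. 1 + z\<^sup>2 \<noteq> 0 \<Longrightarrow> branch s r z = poly_int U z / poly_int V z"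
    using branch_eq_quotient[of s r] by metis
  have ev: "\<forall>\<^sub>F z in at \<i>. branch s r z = poly_int U z / poly_int V z"
    using eventually_one_plus_square_nonzero by (rule eventually_mono) (rule UV(3))
  have "filterlim (\<lambda>z::complex. poly_int U z / poly_int V z) at_infinity (at \<i>)"
    by (rule iffD1[OF filterlim_cong[OF refl refl ev]]) (use r in \<open>auto intro: branch_pole\<close>)
  then show ?thesis
    unfolding pole_germ_def using UV(1) f UV(2) by auto
qed

lemma pole_germ_branch_compose:
  assumes g: "pole_germ g x" and s: "degree s > 0"
    and f: "\<forall>\<^sub>F y in nhds (g x). f y = branch s r y"
  shows "pole_germ (f \<circ> g) x"
proof -
  obtain U V where UV: "\<And>x::real. poly_int V x \<noteq> 0"
      "\<And>x::real. branch s r x = poly_int U x / poly_int V x"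
      "\<And>z::complex. 1 + z\<^sup>2 \<noteq> 0 \<Longrightarrow> branch s r z = poly_int U z / poly_int V z"
    using branch_eq_quotient[of s r] by metis
  have "\<forall>\<^sub>F z in at_infinity. z \<notin> {\<i>, - \<i>}"
    by (auto intro!: eventually_conj eventually_not_equal_at_infinity)
  then have ev: "\<forall>\<^sub>F z::complex in at_infinity. branch s r z = poly_int U z / poly_int V z"
    by (rule eventually_mono) (simp add: UV(3) one_plus_square_eq_0_iff)
  show ?thesis
  proof (rule pole_germ_compose[OF g UV(1)])
    show "\<forall>\<^sub>F y in nhds (g x). f y = poly_int U y / poly_int V y"
      using f by (simp add: UV(2))
    show "filterlim (\<lambda>z::complex. poly_int U z / poly_int V z) at_infinity at_infinity"
      by (rule iffD1[OF filterlim_cong[OF refl refl ev] branch_at_infinity[OF s]])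
  qed
qed

section \<open>Real analyticity and the identity theorem\<close>

lemma real_analytic_at_cong:
  assumes "real_analytic_at u x" "\<forall>\<^sub>F y in nhds x. u y = v y"
  shows "real_analytic_at v x"
proof -
  have "((\<lambda>h. x + h) \<longlongrightarrow> x + 0) (nhds 0)" by (intro tendsto_intros filterlim_ident)
  then have "\<forall>\<^sub>F h in nhds 0. u (x + h) = v (x + h)"
    using eventually_compose_filterlim[OF assms(2), of "\<lambda>h. x + h"] by simp
  moreover obtain F where "fps_conv_radius F > 0" "\<forall>\<^sub>F h in nhds 0. eval_fps F h = u (x + h)"
    using assms(1) unfolding real_analytic_at_def has_fps_expansion_def by blast
  ultimately show ?thesis
    unfolding real_analytic_at_def has_fps_expansion_def
    by (intro exI[of _ F] conjI) (auto elim: eventually_elim2)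
qed

lemma real_analytic_at_add:
  "real_analytic_at u x \<Longrightarrow> real_analytic_at v x \<Longrightarrow> real_analytic_at (\<lambda>y. u y + v y) x"
  unfolding real_analytic_at_def by (elim exE, rule exI, erule (1) has_fps_expansion_add)

lemma real_analytic_at_mult:
  "real_analytic_at u x \<Longrightarrow> real_analytic_at v x \<Longrightarrow> real_analytic_at (\<lambda>y. u y * v y) x"
  unfolding real_analytic_at_def by (elim exE, rule exI, erule (1) has_fps_expansion_mult)

lemma real_analytic_at_const: "real_analytic_at (\<lambda>y. c) x"
  unfolding real_analytic_at_def by (blast intro: has_fps_expansion_const)

lemma real_analytic_at_ident: "real_analytic_at (\<lambda>y. y) x"
  unfolding real_analytic_at_def
  by (rule exI[of _ "fps_const x + fps_X"])
    (intro has_fps_expansion_add has_fps_expansion_const has_fps_expansion_fps_X)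

lemma real_analytic_at_inverse:
  assumes "real_analytic_at u x" "u x \<noteq> 0"
  shows "real_analytic_at (\<lambda>y. inverse (u y)) x"
proof -
  obtain F where F: "(\<lambda>h. u (x + h)) has_fps_expansion F"
    using assms(1) unfolding real_analytic_at_def by blast
  have "fps_nth F 0 \<noteq> 0"
    using has_fps_expansion_imp_0_eq_fps_nth_0[OF F] assms(2) by simp
  then show ?thesis
    unfolding real_analytic_at_def using has_fps_expansion_inverse[OF F] by blast
qed

lemma real_analytic_at_poly: "real_analytic_at (poly p) x"
  by (induction p)
    (simp_all add: real_analytic_at_const real_analytic_at_add real_analytic_at_mult real_analytic_at_ident)

lemma real_analytic_at_branch: "real_analytic_at (branch s r) x"
proof -
  have "1 + x\<^sup>2 \<noteq> 0" using zero_le_power2[of x] by linarith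
  then show ?thesis
    unfolding branch_def[abs_def] divide_inverse power2_eq_square
    by (intro real_analytic_at_add real_analytic_at_mult real_analytic_at_const
        real_analytic_at_ident real_analytic_at_poly real_analytic_at_inverse)
qed

lemma of_real_of_rat: "of_real (of_rat a) = (of_rat a :: complex)"
  by (cases a) (simp add: of_rat_rat)

text \<open>The power series at \<open>e\<close>, read over the complex numbers, is holomorphic on a
  disc. The identity theorem extends the branch formula from one small interval to all real points
  of the disc, so two branches there must coincide.\<close>

lemma real_analytic_branch_unique:
  assumes "real_analytic_at u e"
  obtains \<rho> where "\<rho> > 0"
    "\<And>a b c d s t r. \<lbrakk>a < b; c < d; e - \<rho> < a; b < e + \<rho>; e - \<rho> < c; d < e + \<rho>;
      \<And>x. x \<in> {a<..<b} \<Longrightarrow> u x = branch s r x; \<And>x. x \<in> {c<..<d} \<Longrightarrow> u x = branch t r x\<rbrakk> \<Longrightarrow> s = t"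
proof -
  obtain F where F: "fps_conv_radius F > 0" "\<forall>\<^sub>F h in nhds 0. eval_fps F h = u (e + h)"
    using assms unfolding real_analytic_at_def has_fps_expansion_def by blast
  obtain \<rho>1 where \<rho>1: "\<rho>1 > 0" "\<And>h. \<bar>h\<bar> < \<rho>1 \<Longrightarrow> eval_fps F h = u (e + h)"
    using F(2) unfolding eventually_nhds_metric by (auto simp: dist_real_def)
  obtain \<rho>2 where \<rho>2: "ereal \<rho>2 > 0" "ereal \<rho>2 < fps_conv_radius F"
    using ereal_dense2[OF F(1)] by (auto simp: zero_ereal_def)
  define \<rho> where "\<rho> = min \<rho>1 \<rho>2"
  have \<rho>: "\<rho> > 0" using \<rho>1 \<rho>2 by (simp add: \<rho>_def)
  have \<rho>F: "ereal \<rho> \<le> fps_conv_radius F"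
    using \<rho>2 by (metis \<rho>_def ereal_less_eq(3) less_imp_le min.cobounded2 order_trans)
  define C where "C = Abs_fps (\<lambda>n. complex_of_real (fps_nth F n))"
  have rad: "fps_conv_radius C = fps_conv_radius F"
    by (simp add: C_def fps_conv_radius_def conv_radius_def)
  have evC: "eval_fps C (of_real h) = of_real (u (e + h))" if h: "\<bar>h\<bar> < \<rho>" for h
  proof -
    have "ereal (norm h) < fps_conv_radius F"
      using h \<rho>F by (metis ereal_less(2) ereal_less_eq(1) less_ereal.simps(1) order_less_le_trans real_norm_def)
    then have "summable (\<lambda>n. fps_nth F n * h ^ n)" by (rule summable_fps)
    then have "(\<Sum>n. complex_of_real (fps_nth F n * h ^ n)) = of_real (\<Sum>n. fps_nth F n * h ^ n)"
      by (rule suminf_of_real[symmetric])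
    then show ?thesis using \<rho>1(2)[of h] h by (simp add: eval_fps_def C_def \<rho>_def)
  qed
  have extend: "u x = branch s r x"
    if ab: "a < b" "e - \<rho> < a" "b < e + \<rho>" and eq: "\<And>x. x \<in> {a<..<b} \<Longrightarrow> u x = branch s r x"
      and x: "e - \<rho> < x" "x < e + \<rho>" for a b s r x
  proof -
    \<comment> \<open>The difference of series and branch, multiplied by 1 + z^2: the disc may
      contain \<i> and -\<i>, and clearing the denominator keeps \<open>G\<close> holomorphic
      there.\<close>
    define G where "G = (\<lambda>z. eval_fps C (z - of_real e) * (1 + z\<^sup>2) - (poly_rat s z * (1 + z\<^sup>2) + of_rat r))"
    have G_real: "G (of_real y) = of_real ((u y - branch s r y) * (1 + y\<^sup>2))"
      if y: "e - \<rho> < y" "y < e + \<rho>" for y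
    proof -
      have "1 + y\<^sup>2 \<noteq> 0" using zero_le_power2[of y] by linarith
      then have "(u y - branch s r y) * (1 + y\<^sup>2) = u y * (1 + y\<^sup>2) - (poly_rat s y * (1 + y\<^sup>2) + of_rat r)"
        by (simp add: branch_def field_simps)
      moreover have "eval_fps C (of_real y - of_real e) = of_real (u y)"
        using evC[of "y - e"] y by (simp add: abs_less_iff)
      moreover have "poly_rat s (complex_of_real y) = of_real (poly_rat s y)"
        by (induction s) (simp_all add: of_real_of_rat)
      ultimately show ?thesis by (simp add: G_def of_real_of_rat)
    qed
    define m where "m = (a + b) / 2"
    have m: "m \<in> {a<..<b}" using ab by (simp add: m_def)
    have hol: "G holomorphic_on ball (of_real e) \<rho>"
    proof -
      have "(\<lambda>z. eval_fps C (z - of_real e)) holomorphic_on ball (complex_of_real e) \<rho>"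
      proof (rule holomorphic_on_compose_gen[of "\<lambda>z. z - of_real e" _ "eval_fps C" "eball 0 (fps_conv_radius C)", unfolded comp_def])
        show "(\<lambda>z. z - of_real e) ` ball (complex_of_real e) \<rho> \<subseteq> eball 0 (fps_conv_radius C)"
        proof (rule image_subsetI)
          fix z :: complex assume "z \<in> ball (of_real e) \<rho>"
          then have "ereal (norm (z - of_real e)) < ereal \<rho>" by (simp add: dist_norm norm_minus_commute)
          then have "ereal (norm (z - of_real e)) < fps_conv_radius C"
            unfolding rad using \<rho>F by (rule order_less_le_trans)
          then show "z - of_real e \<in> eball 0 (fps_conv_radius C)" by (simp add: in_eball_iff)
        qed
      qed (auto intro!: holomorphic_intros)
      moreover have "poly_rat s holomorphic_on ball (of_real e :: complex) \<rho>"
      proof -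
        have "poly_rat s = (\<lambda>z::complex. \<Sum>i\<le>degree s. of_rat (coeff s i) * z ^ i)"
          by (simp add: fun_eq_iff poly_altdef degree_map_poly coeff_map_poly)
        then show ?thesis by (auto intro!: holomorphic_intros)
      qed
      ultimately show ?thesis unfolding G_def by (intro holomorphic_intros)
    qed
    have lp: "of_real m islimpt complex_of_real ` {a<..<b}"
      unfolding islimpt_approachable
    proof (intro allI impI)
      fix \<epsilon> :: real assume "\<epsilon> > 0"
      define y where "y = m + min \<epsilon> (b - m) / 2"
      have "y \<in> {a<..<b}" "y \<noteq> m" "\<bar>y - m\<bar> < \<epsilon>"
      proof -
        define k where "k = min \<epsilon> (b - m)"
        have "k > 0" "k \<le> \<epsilon>" "k \<le> b - m" using m \<open>\<epsilon> > 0\<close> by (auto simp: k_def)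
        moreover have "y = m + k / 2" by (simp add: y_def k_def)
        ultimately show "y \<in> {a<..<b}" "y \<noteq> m" "\<bar>y - m\<bar> < \<epsilon>" using m by auto
      qed
      then show "\<exists>z\<in>complex_of_real ` {a<..<b}. z \<noteq> of_real m \<and> dist z (of_real m) < \<epsilon>"
        by (intro bexI[of _ "complex_of_real y"] imageI) (auto simp: dist_real_def)
    qed
    have G0: "G (of_real x) = 0"
    proof (rule analytic_continuation[OF hol open_ball connected_ball _ _ lp])
      show "complex_of_real ` {a<..<b} \<subseteq> ball (of_real e) \<rho>"
        using ab by (auto simp: dist_real_def abs_less_iff)
      show "complex_of_real m \<in> ball (of_real e) \<rho>"
        using m ab by (simp add: dist_real_def abs_less_iff)
      show "complex_of_real x \<in> ball (of_real e) \<rho>"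
        using x by (simp add: dist_real_def abs_less_iff)
      show "G z = 0" if z: "z \<in> complex_of_real ` {a<..<b}" for z
      proof -
        obtain y where y: "z = of_real y" "y \<in> {a<..<b}" using z by blast
        then show ?thesis using G_real[of y] eq[of y] ab by simp
      qed
    qed
    have "complex_of_real ((u x - branch s r x) * (1 + x\<^sup>2)) = 0" using G_real[OF x] G0 by metis
    then have "(u x - branch s r x) * (1 + x\<^sup>2) = 0" by (simp only: of_real_eq_0_iff)
    moreover have "1 + x\<^sup>2 \<noteq> 0" using zero_le_power2[of x] by linarith
    ultimately show ?thesis by simp
  qed
  show thesis
  proof (rule that[OF \<rho>])
    fix a b c d s t r
    assume ab: "a < b" "e - \<rho> < a" "b < e + \<rho>" "\<And>x. x \<in> {a<..<b} \<Longrightarrow> u x = branch s r x"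
      and cd: "c < d" "e - \<rho> < c" "d < e + \<rho>" "\<And>x. x \<in> {c<..<d} \<Longrightarrow> u x = branch t r x"
    have "poly_rat s x = poly_rat t x" if "x \<in> {a<..<b}" for x
      using extend[OF cd, of x] ab(2,3) ab(4)[OF that] that by (simp add: branch_def)
    then show "s = t" using ab(1) by (intro poly_rat_inject[of "{a<..<b}"]) auto
  qed
qed


subsection \<open>The diffeomorphisms\<close>

lemma ex_poly_clearing_branch:
  "\<exists>Q N. \<forall>x::real. poly Q x = (1 + x\<^sup>2) ^ N * poly (poly P [:branch s r x:]) x"
proof (induction P)
  case 0
  show ?case by (intro exI[of _ 0]) simp
next
  case (pCons a P)
  then obtain Q N where Q: "\<And>x::real. poly Q x = (1 + x\<^sup>2) ^ N * poly (poly P [:branch s r x:]) x"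
    by blast
  define den where "den = ([:1, 0, 1:] :: real poly)"
  have den: "poly den x = 1 + x\<^sup>2" for x by (simp add: den_def power2_eq_square)
  define num where "num = map_poly of_rat s * den + [:of_rat r:]"
  have num: "poly num x = (1 + x\<^sup>2) * branch s r x" for x
  proof -
    have "1 + x\<^sup>2 \<noteq> 0" using zero_le_power2[of x] by linarith
    then show ?thesis by (simp add: num_def den branch_def field_simps)
  qed
  have "poly (den ^ Suc N * a + num * Q) x =
      (1 + x\<^sup>2) ^ Suc N * poly (poly (pCons a P) [:branch s r x:]) x" for x
    by (simp add: num den Q algebra_simps)
  then show ?case by blast
qed

lemma algebraic_relation_branch_extends:
  assumes "a < b" "\<And>x::real. x \<in> {a<..<b} \<Longrightarrow> poly (poly P [:branch s r x:]) x = 0"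
  shows "poly (poly P [:branch s r x:]) x = 0"
proof -
  obtain Q N where Q: "\<And>x::real. poly Q x = (1 + x\<^sup>2) ^ N * poly (poly P [:branch s r x:]) x"
    using ex_poly_clearing_branch by blast
  have "Q = 0"
  proof (rule ccontr)
    assume "Q \<noteq> 0"
    then have "finite {x. poly Q x = 0}" by (rule poly_roots_finite)
    moreover have "{a<..<b} \<subseteq> {x. poly Q x = 0}" using assms(2) by (auto simp: Q)
    ultimately show False using infinite_Ioo[OF assms(1)] finite_subset by blast
  qed
  then have "(1 + x\<^sup>2) ^ N * poly (poly P [:branch s r x:]) x = 0" using Q[of x] by simp
  moreover have "1 + x\<^sup>2 \<noteq> 0" using zero_le_power2[of x] by linarith
  ultimately show ?thesis by simp
qed

text \<open>Take one branch more than the degree of \<open>P\<close> in Y. At a point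
  \<open>x\<close> where the leading coefficient is nonzero and these branches have distinct values,
  P(x, Y) would have more roots than its degree.\<close>

lemma infinite_branches_transcendental:
  assumes inf: "infinite S" and P: "P \<noteq> 0"
  shows "\<exists>s\<in>S. \<exists>x::real. poly (poly P [:branch s r x:]) x \<noteq> 0"
proof (rule ccontr)
  assume "\<not> ?thesis"
  then have all: "poly (poly P [:branch s r x:]) x = 0" if "s \<in> S" for s and x :: real
    using that by blast
  obtain T where T: "finite T" "card T = Suc (degree P)" "T \<subseteq> S"
    using infinite_arbitrarily_large[OF inf] by blast
  define bad where "bad = {x. poly (lead_coeff P) x = 0} \<union>
    (\<Union>(s, t)\<in>{(s, t) \<in> T \<times> T. s \<noteq> t}. {x::real. poly_rat s x = poly_rat t x})"
  have "finite bad"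
    unfolding bad_def
  proof (intro finite_UnI finite_UN_I)
    show "finite {x. poly (lead_coeff P) x = 0}" using P by (intro poly_roots_finite) simp
    show "finite {(s, t) \<in> T \<times> T. s \<noteq> t}"
      by (rule finite_subset[of _ "T \<times> T"]) (use T in auto)
    fix st assume "st \<in> {(s, t) \<in> T \<times> T. s \<noteq> t}"
    then show "finite (case st of (s, t) \<Rightarrow> {x::real. poly_rat s x = poly_rat t x})"
      using poly_rat_inject[of "{x::real. poly_rat s x = poly_rat t x}" for s t] by fastforce
  qed
  then obtain x where x: "x \<notin> bad" using ex_new_if_finite infinite_UNIV_char_0 by blast
  define p where "p = map_poly (\<lambda>a. poly a x) P"
  have p: "poly p y = poly (poly P [:y:]) x" for y
    unfolding p_def by (induction P) (simp_all add: map_poly_pCons)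
  have "coeff p (degree P) \<noteq> 0" using x by (simp add: p_def bad_def coeff_map_poly)
  then have "p \<noteq> 0" by auto
  have "inj_on (\<lambda>s. branch s r x) T"
    using x by (auto simp: inj_on_def bad_def branch_def)
  then have "Suc (degree P) = card ((\<lambda>s. branch s r x) ` T)"
    using T(2) by (simp add: card_image)
  also have "\<dots> \<le> card {y. poly p y = 0}"
    using T(3) all by (intro card_mono poly_roots_finite \<open>p \<noteq> 0\<close>) (auto simp: p)
  also have "\<dots> \<le> degree p" using \<open>p \<noteq> 0\<close> by (rule card_poly_roots_bound)
  also have "\<dots> \<le> degree P" unfolding p_def by (rule map_poly_degree_leq)
  finally show False by simp
qed

lemma smooth_inverse_one_plus_square: "smooth (\<lambda>x. inverse (1 + x\<^sup>2))"
proof (rule smooth_inverse)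
  show "smooth (\<lambda>x. 1 + x\<^sup>2)"
    unfolding power2_eq_square by (intro smooth_add smooth_mult smooth_const smooth_ident)
  show "1 + x\<^sup>2 \<noteq> 0" for x :: real using zero_le_power2[of x] by linarith
qed

lemma abs_deriv_inverse_one_plus_square_le: "\<bar>deriv (\<lambda>x::real. inverse (1 + x\<^sup>2)) x\<bar> \<le> 1"
proof -
  have pos: "1 + x\<^sup>2 \<ge> 1" by simp
  have ne: "1 + x * x \<noteq> 0" using zero_le_square[of x] by linarith
  have "((\<lambda>x::real. inverse (1 + x\<^sup>2)) has_real_derivative - (2 * x) / (1 + x\<^sup>2)\<^sup>2) (at x)"
    using ne by (auto intro!: derivative_eq_intros simp: power2_eq_square divide_inverse)
  then have "deriv (\<lambda>x::real. inverse (1 + x\<^sup>2)) x = - (2 * x) / (1 + x\<^sup>2)\<^sup>2"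
    by (rule DERIV_imp_deriv)
  moreover have "\<bar>2 * x\<bar> \<le> 1 + x\<^sup>2"
    using zero_le_power2[of "\<bar>x\<bar> - 1"] by (simp add: power2_diff abs_mult)
  moreover have "(1 + x\<^sup>2) * 1 \<le> (1 + x\<^sup>2)\<^sup>2"
    unfolding power2_eq_square[of "1 + x\<^sup>2"] using pos by (intro mult_left_mono) auto
  ultimately show ?thesis using pos by (simp add: abs_divide divide_le_eq abs_mult)
qed

section \<open>Assembling the diffeomorphisms\<close>

context perfect_nowhere_dense
begin

lemma connected_subset_gap:
  assumes "connected I" "I \<inter> E = {}" "(a, b) \<in> gaps" "x \<in> I" "a < x" "x < b"
  shows "I \<subseteq> {a<..<b}"
proof
  fix y assume y: "y \<in> I"
  have "y > a"
  proof (rule ccontr)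
    assume "\<not> y > a"
    then have "a \<in> {y..x}" using assms by auto
    then have "a \<in> I" using connected_contains_Icc[OF assms(1) y assms(4)] by blast
    then show False using gapsD(2)[OF assms(3)] assms(2) by blast
  qed
  moreover have "y < b"
  proof (rule ccontr)
    assume "\<not> y < b"
    then have "b \<in> {x..y}" using assms by auto
    then have "b \<in> I" using connected_contains_Icc[OF assms(1,4) y] by blast
    then show False using gapsD(3)[OF assms(3)] assms(2) by blast
  qed
  ultimately show "y \<in> {a<..<b}" by simp
qed

lemma connected_subset_outside:
  assumes "connected I" "I \<inter> E = {}" "x \<in> I" "x < Inf E \<or> Sup E < x"
  shows "I \<subseteq> {..<Inf E} \<or> I \<subseteq> {Sup E<..}"
proof (rule ccontr)
  assume "\<not> ?thesis"
  then obtain y z where "y \<in> I" "y \<notin> {..<Inf E}" "z \<in> I" "z \<notin> {Sup E<..}" by blast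
  then have yz: "y \<in> I" "Inf E \<le> y" "z \<in> I" "z \<le> Sup E" by auto
  from assms(4) have "Inf E \<in> I \<or> Sup E \<in> I"
  proof
    assume "x < Inf E"
    then have "Inf E \<in> {x..y}" using yz by auto
    then show ?thesis using connected_contains_Icc[OF assms(1,3) yz(1)] by blast
  next
    assume "Sup E < x"
    then have "Sup E \<in> {z..x}" using yz by auto
    then show ?thesis using connected_contains_Icc[OF assms(1) yz(3) assms(3)] by blast
  qed
  then show False using Inf_mem Sup_mem assms(2) by blast
qed

lemma rational_off_diffeo_perturbation:
  assumes E: "E \<inter> ({x. algebraic x} \<union> liouville_numbers) = {}"
    and w: "smooth w" "\<And>x. x \<le> Inf E \<or> Sup E \<le> x \<Longrightarrow> w x = 0"
      "\<And>x. \<bar>w x\<bar> \<le> 1 / 4" "\<And>x. \<bar>deriv w x\<bar> \<le> 1 / 4"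
    and p: "\<And>a b x. (a, b) \<in> gaps \<Longrightarrow> x \<in> {a..b} \<Longrightarrow> w x = poly_rat (p (a, b)) x" "inj_on p gaps"
    and r: "0 < r" "r \<le> 1 / 4"
  shows "rational_off_diffeo E (\<lambda>x. x + of_rat r * inverse (1 + x\<^sup>2) + w x)"
proof -
  define f where "f = (\<lambda>x. x + of_rat r * inverse (1 + x\<^sup>2) + w x)"
  define s where "s = (\<lambda>g. [:0, 1:] + p g)"
  have rr: "0 < real_of_rat r" "real_of_rat r \<le> 1 / 4"
    using r of_rat_less_eq[of r "1 / 4"] by (simp_all add: of_rat_divide)
  have sf: "smooth f"
    unfolding f_def
    by (intro smooth_add smooth_cmult smooth_ident w(1) smooth_inverse_one_plus_square)
  have f_gap: "f x = branch (s (a, b)) r x" if "(a, b) \<in> gaps" "x \<in> {a..b}" for a b x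
    using p(1)[OF that] by (simp add: f_def branch_def s_def divide_inverse)
  have f_out: "f x = branch [:0, 1:] r x" if "x \<le> Inf E \<or> Sup E \<le> x" for x
    using w(2)[OF that] by (simp add: f_def branch_def divide_inverse)
  \<comment> \<open>Needed for R(\<infinity>) = \<infinity>. A constant x + p would force w' = -1 on
    the gap, against the bound 1/4.\<close>
  have deg: "degree (s (a, b)) > 0" if g: "(a, b) \<in> gaps" for a b
  proof (rule ccontr)
    assume "\<not> ?thesis"
    then obtain c where c: "s (a, b) = [:c:]" by (auto elim: degree_eq_zeroE)
    have wx: "w x = of_rat c - x" if "x \<in> {a<..<b}" for x
      using p(1)[OF g, of x] that arg_cong[OF c, of "\<lambda>q. poly_rat q x"] by (simp add: s_def)
    define m where "m = (a + b) / 2"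
    have m: "m \<in> {a<..<b}" using gapsD(1)[OF g] by (simp add: m_def)
    have "\<forall>\<^sub>F x in nhds m. x \<in> {a<..<b}" by (rule eventually_nhds_in_open) (use m in auto)
    then have "\<forall>\<^sub>F x in nhds m. w x = of_rat c - x" by (rule eventually_mono) (rule wx)
    then have "deriv w m = deriv (\<lambda>x. of_rat c - x) m" by (rule deriv_cong_ev) simp
    also have "\<dots> = - 1" by (rule DERIV_imp_deriv) (auto intro!: derivative_eq_intros)
    finally show False using w(4)[of m] by simp
  qed
  \<comment> \<open>Stated for arbitrary connected sets off \<open>E\<close>, so that it serves the
    components and also small balls around single points.\<close>
  have piece: "\<exists>t. degree t > 0 \<and> (\<forall>y\<in>I. f y = branch t r y)"
    if I: "connected I" "I \<inter> E = {}" "x \<in> I" for I x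
  proof (cases "x < Inf E \<or> Sup E < x")
    case True
    then have "f y = branch [:0, 1:] r y" if "y \<in> I" for y
      using connected_subset_outside[OF I] that by (intro f_out) auto
    then show ?thesis by (intro exI[of _ "[:0, 1:]"]) simp
  next
    case False
    then obtain a b where ab: "(a, b) \<in> gaps" "a < x" "x < b"
      using mem_gap[of x] I by (auto simp: not_less)
    have "I \<subseteq> {a<..<b}" by (rule connected_subset_gap[OF I(1,2) ab(1) I(3) ab(2,3)])
    then have "f y = branch (s (a, b)) r y" if "y \<in> I" for y
      using that by (intro f_gap[OF ab(1)]) auto
    then show ?thesis using deg[OF ab(1)] by blast
  qed
  have local: "\<exists>t. degree t > 0 \<and> (\<forall>\<^sub>F y in nhds x. f y = branch t r y)" if x: "x \<notin> E" for x
  proof -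
    obtain \<delta> where \<delta>: "\<delta> > 0" "ball x \<delta> \<subseteq> - E"
      using closed x by (metis ComplI open_Compl open_contains_ball)
    have "ball x \<delta> \<inter> E = {}" "x \<in> ball x \<delta>" using \<delta> by auto
    from piece[OF connected_ball this]
    obtain t where t: "degree t > 0" "\<forall>y\<in>ball x \<delta>. f y = branch t r y" by blast
    have "\<forall>\<^sub>F y in nhds x. f y = branch t r y"
      using eventually_nhds_ball[OF \<delta>(1), of x] by (rule eventually_mono) (use t in blast)
    then show ?thesis using t by blast
  qed
  have germ: "pole_germ f x" if x: "x \<notin> E" for x
  proof -
    obtain t where "\<forall>\<^sub>F y in nhds x. f y = branch t r y" using local[OF x] by blast
    then show ?thesis by (rule pole_germ_branch[rotated]) (use r(1) in simp)
  qed
  \<comment> \<open>\<open>X\<close> will be a number field or the set of Liouville numbers.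
    Invariance keeps the whole orbit off \<open>E\<close>, so each further application of
    \<open>f\<close> is a branch near the current point.\<close>
  have germ_iter: "pole_germ (f ^^ Suc n) x" if X: "X \<inter> E = {}" "f ` X \<subseteq> X" "x \<in> X" for X x n
  proof (induction n)
    case 0
    show ?case using germ[of x] X by auto
  next
    case (Suc n)
    have "(f ^^ k) x \<in> X" for k by (induction k) (use X in auto)
    then have "(f ^^ Suc n) x \<notin> E" using X(1) by blast
    then obtain t where "degree t > 0" "\<forall>\<^sub>F y in nhds ((f ^^ Suc n) x). f y = branch t r y"
      using local by blast
    from pole_germ_branch_compose[OF Suc this]
    show ?case by (simp add: comp_def)
  qed
  have "orientation_preserving_diffeo f"
  proof (rule orientation_preserving_diffeoI[OF sf])
    fix x
    have "(f has_real_derivative 1 + of_rat r * deriv (\<lambda>x. inverse (1 + x\<^sup>2)) x + deriv w x) (at x)"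
      unfolding f_def
      by (intro DERIV_add DERIV_ident DERIV_cmult smooth_DERIV smooth_inverse_one_plus_square w(1))
    then have "deriv f x = 1 + of_rat r * deriv (\<lambda>x. inverse (1 + x\<^sup>2)) x + deriv w x"
      by (rule DERIV_imp_deriv)
    moreover have "\<bar>real_of_rat r * deriv (\<lambda>x. inverse (1 + x\<^sup>2)) x\<bar> \<le> 1 / 4 * 1"
      unfolding abs_mult using rr abs_deriv_inverse_one_plus_square_le[of x] by (intro mult_mono) auto
    ultimately show "deriv f x > 0" using w(4)[of x] by linarith
    have "1 + x\<^sup>2 \<ge> 1" by simp
    then have "\<bar>inverse (1 + x\<^sup>2)\<bar> \<le> 1" by (simp add: inverse_le_1_iff)
    then have "\<bar>real_of_rat r * inverse (1 + x\<^sup>2)\<bar> \<le> 1 / 4 * 1"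
      unfolding abs_mult using rr by (intro mult_mono) auto
    then show "\<bar>f x - x\<bar> \<le> 1" using w(3)[of x] by (simp add: f_def)
  qed
  moreover have "NA f = E"
  proof (intro equalityI subsetI)
    fix x assume "x \<in> NA f"
    then have na: "\<not> real_analytic_at f x" by (simp add: NA_def)
    show "x \<in> E"
    proof (rule ccontr)
      assume "x \<notin> E"
      then obtain t where "\<forall>\<^sub>F y in nhds x. f y = branch t r y" using local by blast
      then have "\<forall>\<^sub>F y in nhds x. branch t r y = f y" by (rule eventually_mono) simp
      then show False using na real_analytic_at_cong[OF real_analytic_at_branch] by blast
    qed
  next
    fix e assume e: "e \<in> E"
    show "e \<in> NA f"
      unfolding NA_def
    proof (intro CollectI notI)
      assume "real_analytic_at f e"
      then obtain \<rho> where \<rho>: "\<rho> > 0" and uniq: "\<And>a b c d s t r. \<lbrakk>a < b; c < d; e - \<rho> < a; b < e + \<rho>;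
          e - \<rho> < c; d < e + \<rho>; \<And>x. x \<in> {a<..<b} \<Longrightarrow> f x = branch s r x;
          \<And>x. x \<in> {c<..<d} \<Longrightarrow> f x = branch t r x\<rbrakk> \<Longrightarrow> s = t"
        by (rule real_analytic_branch_unique) blast
      obtain a b c d where g: "(a, b) \<in> gaps" "(c, d) \<in> gaps" "(a, b) \<noteq> (c, d)"
        and near: "e - \<rho> < a" "b < e + \<rho>" "e - \<rho> < c" "d < e + \<rho>"
        by (rule two_gaps_near[OF e \<rho>])
      have "s (a, b) = s (c, d)"
      proof (rule uniq[OF gapsD(1)[OF g(1)] gapsD(1)[OF g(2)] near])
        show "f x = branch (s (a, b)) r x" if "x \<in> {a<..<b}" for x
          using that by (intro f_gap[OF g(1)]) auto
        show "f x = branch (s (c, d)) r x" if "x \<in> {c<..<d}" for x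
          using that by (intro f_gap[OF g(2)]) auto
      qed
      then have "p (a, b) = p (c, d)" by (simp add: s_def)
      then show False using inj_onD[OF p(2) _ g(1,2)] g(3) by blast
    qed
  qed
  moreover have "\<forall>I\<in>components (- E). \<exists>R :: rat poly fract. (\<forall>x\<in>I. f x = ratfun_eval R x) \<and>
      {z::complex. is_pole (ratfun_eval R) z} = {\<i>, - \<i>} \<and>
      filterlim (ratfun_eval R :: complex \<Rightarrow> complex) at_infinity at_infinity"
  proof
    fix I assume I: "I \<in> components (- E)"
    then obtain x where "x \<in> I" using in_components_nonempty by blast
    moreover have "connected I" "I \<inter> E = {}"
      using in_components_connected[OF I] in_components_subset[OF I] by auto
    ultimately obtain t where t: "degree t > 0" "\<forall>y\<in>I. f y = branch t r y"
      using piece by blast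
    then show "\<exists>R :: rat poly fract. (\<forall>x\<in>I. f x = ratfun_eval R x) \<and>
        {z::complex. is_pole (ratfun_eval R) z} = {\<i>, - \<i>} \<and>
        filterlim (ratfun_eval R :: complex \<Rightarrow> complex) at_infinity at_infinity"
      using ratfun_branch_exists[OF _ t(1), of r] r(1) by force
  qed
  moreover have "\<not> algebraic_over_ratfuns UNIV f"
  proof
    assume "algebraic_over_ratfuns UNIV f"
    then obtain P where P: "P \<noteq> 0" "\<And>x. poly (poly P [:f x:]) x = 0"
      unfolding algebraic_over_ratfuns_def by blast
    have "inj_on s gaps" using p(2) by (simp add: inj_on_def s_def)
    then have "infinite (s ` gaps)" using infinite_gaps by (simp add: finite_image_iff)
    then obtain g x where g: "g \<in> gaps" and ne: "poly (poly P [:branch (s g) r x:]) x \<noteq> 0"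
      using infinite_branches_transcendental[OF _ P(1)] by blast
    obtain a b where ab: "g = (a, b)" by (cases g)
    have "poly (poly P [:branch (s g) r x:]) x = 0"
    proof (rule algebraic_relation_branch_extends)
      show "a < b" using g ab by (auto dest: gapsD)
      show "poly (poly P [:branch (s g) r y:]) y = 0" if "y \<in> {a<..<b}" for y
        using P(2)[of y] f_gap[of a b y] g ab that by simp
    qed
    then show False using ne by simp
  qed
  moreover have "(deriv ^^ m) (f ^^ n) ` K \<subseteq> K" if K: "real_number_field K" and n: "n \<ge> 1" for K n m
  proof -
    have KE: "K \<inter> E = {}" using number_field_algebraic[OF K] E by blast
    have fK: "f ` K \<subseteq> K"
      using rational_germ_number_field[OF K] pole_germ_imp_rational_germ germ KE by blast
    obtain k where k: "n = Suc k" using n by (cases n) auto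
    show ?thesis
      unfolding k
      using rational_germ_number_field[OF K _ rational_germ_higher_deriv[OF
          pole_germ_imp_rational_germ[OF germ_iter[OF KE fK]]]] by blast
  qed
  moreover have "(deriv ^^ m) (f ^^ n) ` liouville_numbers \<subseteq> liouville_numbers" if n: "n \<ge> 1" for n m
  proof -
    have LE: "liouville_numbers \<inter> E = {}" using E by blast
    \<comment> \<open>The case of order 0 gives invariance of the Liouville numbers under
      \<open>f\<close>; this licenses \<open>germ_iter\<close>, and the same fact then applies to
      all derivatives of the iterates.\<close>
    have liou: "(deriv ^^ m) g x \<in> liouville_numbers" if "x \<in> liouville_numbers" "pole_germ g x" for g x m
      using rational_germ_liouville[OF rational_germ_higher_deriv[OF pole_germ_imp_rational_germ]]
        pole_germ_higher_deriv_not_const that by blast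
    have fL: "f ` liouville_numbers \<subseteq> liouville_numbers"
      using liou[where m = 0] germ LE by auto
    obtain k where k: "n = Suc k" using n by (cases n) auto
    show ?thesis
      unfolding k using liou germ_iter[OF LE fL] by blast
  qed
  ultimately have "rational_off_diffeo E f"
    unfolding rational_off_diffeo_def by blast
  then show ?thesis by (simp add: f_def)
qed

lemma ex_rational_off_diffeo_near_id:
  assumes E: "E \<inter> ({x. algebraic x} \<union> liouville_numbers) = {}"
  shows "\<exists>f. rational_off_diffeo E f \<and> (\<forall>A r. r \<le> n \<longrightarrow> smooth_seminorm A r (\<lambda>x. f x - id x) \<le>
    (smooth_seminorm A r (\<lambda>x. inverse (1 + x\<^sup>2)) + 1) * inverse (real (n + 4)))"
proof -
  \<comment> \<open>One parameter bounds both w and the coefficient of the pole term; the offset 4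
    keeps it at most 1/4 already for n = 0. Below, order \<open>Suc n\<close> is requested so that
    w' is controlled even then.\<close>
  define \<eta> where "\<eta> = inverse (real (n + 4))"
  define q where "q = inverse (rat_of_nat (n + 4))"
  have q: "0 < q" "q \<le> 1 / 4" by (auto simp: q_def field_simps)
  have q\<eta>: "real_of_rat q = \<eta>"
    unfolding q_def \<eta>_def by (simp only: of_rat_inverse of_rat_of_nat_eq)
  have \<eta>: "\<eta> > 0" "\<eta> \<le> 1 / 4" by (auto simp: \<eta>_def field_simps)
  obtain w p where "smooth w \<and> (\<forall>x. x \<le> Inf E \<or> Sup E \<le> x \<longrightarrow> w x = 0) \<and>
      (\<forall>j\<le>Suc n. \<forall>x. \<bar>(deriv ^^ j) w x\<bar> \<le> \<eta>) \<and>
      (\<forall>(a, b)\<in>gaps. \<forall>x\<in>{a..b}. w x = poly_rat (p (a, b)) x) \<and> inj_on p gaps"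
    using ex_smooth_poly_on_gaps[OF \<eta>(1), of "Suc n"] by (elim exE) (rule that)
  then have w: "smooth w" "\<And>x. x \<le> Inf E \<or> Sup E \<le> x \<Longrightarrow> w x = 0"
      "\<And>j x. j \<le> Suc n \<Longrightarrow> \<bar>(deriv ^^ j) w x\<bar> \<le> \<eta>"
    and p: "\<And>a b x. (a, b) \<in> gaps \<Longrightarrow> x \<in> {a..b} \<Longrightarrow> w x = poly_rat (p (a, b)) x" "inj_on p gaps"
    by auto
  define h where "h = (\<lambda>x::real. inverse (1 + x\<^sup>2))"
  have h: "smooth h" unfolding h_def by (rule smooth_inverse_one_plus_square)
  define f where "f = (\<lambda>x. x + of_rat q * inverse (1 + x\<^sup>2) + w x)"
  show ?thesis
  proof (intro exI[of _ f] conjI allI impI)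
    show "rational_off_diffeo E f"
      unfolding f_def
    proof (rule rational_off_diffeo_perturbation[OF E w(1,2) _ _ p q])
      show "\<bar>w x\<bar> \<le> 1 / 4" for x using w(3)[of 0 x] \<eta>(2) by simp
      show "\<bar>deriv w x\<bar> \<le> 1 / 4" for x using w(3)[of 1 x] \<eta>(2) by simp
    qed
    fix A r assume r: "r \<le> n"
    show "smooth_seminorm A r (\<lambda>x. f x - id x) \<le>
        (smooth_seminorm A r (\<lambda>x. inverse (1 + x\<^sup>2)) + 1) * inverse (real (n + 4))"
    proof (rule smooth_seminorm_le)
      fix j x assume j: "j \<le> r" and x: "x \<in> {- real A..real A}"
      have "(\<lambda>x. f x - id x) = (\<lambda>x. \<eta> * h x + w x)" by (simp add: fun_eq_iff f_def h_def q\<eta>)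
      then have "(deriv ^^ j) (\<lambda>x. f x - id x) x = \<eta> * (deriv ^^ j) h x + (deriv ^^ j) w x"
        by (simp add: smooth_higher_deriv_add smooth_higher_deriv_cmult smooth_cmult h w(1))
      moreover have "\<bar>\<eta> * (deriv ^^ j) h x\<bar> \<le> \<eta> * smooth_seminorm A r h"
        unfolding abs_mult using \<eta>(1) abs_higher_deriv_le_seminorm[OF h j x]
        by (intro mult_mono) auto
      moreover have "\<bar>(deriv ^^ j) w x\<bar> \<le> \<eta>" using w(3)[of j x] j r by simp
      ultimately have "\<bar>(deriv ^^ j) (\<lambda>x. f x - id x) x\<bar> \<le> (smooth_seminorm A r h + 1) * \<eta>"
        by (simp add: algebra_simps)
      then show "\<bar>(deriv ^^ j) (\<lambda>x. f x - id x) x\<bar> \<le>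
          (smooth_seminorm A r (\<lambda>x. inverse (1 + x\<^sup>2)) + 1) * inverse (real (n + 4))"
        by (simp only: h_def \<eta>_def)
    qed
  qed
qed

end

theorem theorem6p1:
  fixes E :: "real set"
  assumes "E \<noteq> {}"
    and "compact E"
    and "perfect_set E"
    and "interior (closure E) = {}"
    and "E \<inter> ({x. algebraic x} \<union> liouville_numbers) = {}"
  shows "(\<forall>U. nbhd_in smooth_topology id U \<longrightarrow> (\<exists>f\<in>U. rational_off_diffeo E f)) \<and>
         (\<exists>F :: nat \<Rightarrow> real \<Rightarrow> real.
            (\<forall>\<nu>. rational_off_diffeo E (F \<nu>)) \<and>
            limitin smooth_topology F id sequentially)"
proof -
  interpret perfect_nowhere_dense E
    using assms(1-4) by unfold_locales
  define h where "h = (\<lambda>x::real. inverse (1 + x\<^sup>2))"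
  \<comment> \<open>One sequence proves both claims: for fixed \<open>A\<close> and \<open>r\<close>
    the bound applies once n \<ge> r and tends to 0, and a sequence converging to the identity
    enters each of its neighbourhoods.\<close>
  obtain F where F: "\<And>n. rational_off_diffeo E (F n)"
    and bd: "\<And>n A r. r \<le> n \<Longrightarrow> smooth_seminorm A r (\<lambda>x. F n x - id x) \<le>
      (smooth_seminorm A r h + 1) * inverse (real (n + 4))"
    using ex_rational_off_diffeo_near_id[OF assms(5)] unfolding h_def by metis
  have sF: "smooth (F n)" for n
    using F[of n] by (simp add: rational_off_diffeo_def orientation_preserving_diffeo_def)
  have sid: "smooth id" using smooth_ident by (simp add: id_def)
  have lim: "limitin smooth_topology F id sequentially"
  proof (rule limitin_smooth_topologyI[OF sF sid])
    fix A r
    have "(\<lambda>n. inverse (real (n + 4))) \<longlonglongrightarrow> 0"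
      using LIMSEQ_ignore_initial_segment[OF lim_inverse_n, of 4] by simp
    then have lim0: "(\<lambda>n. (smooth_seminorm A r h + 1) * inverse (real (n + 4))) \<longlonglongrightarrow> 0"
      by (rule tendsto_mult_right_zero)
    show "(\<lambda>n. smooth_seminorm A r (\<lambda>x. F n x - id x)) \<longlonglongrightarrow> 0"
    proof (rule tendsto_sandwich[OF _ _ tendsto_const lim0])
      have "0 \<le> smooth_seminorm A r (\<lambda>x. F n x - id x)" for n
        using abs_higher_deriv_le_seminorm[OF smooth_diff[OF sF sid], of 0 r 0 A n]
        by (simp del: id_apply)
      then show "\<forall>\<^sub>F n in sequentially. 0 \<le> smooth_seminorm A r (\<lambda>x. F n x - id x)" by simp
      show "\<forall>\<^sub>F n in sequentially. smooth_seminorm A r (\<lambda>x. F n x - id x) \<le>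
          (smooth_seminorm A r h + 1) * inverse (real (n + 4))"
        using eventually_ge_at_top[of r] by eventually_elim (rule bd)
    qed
  qed
  show ?thesis
  proof (intro conjI allI impI)
    fix U assume "nbhd_in smooth_topology id U"
    then obtain V where V: "openin smooth_topology V" "id \<in> V" "V \<subseteq> U"
      unfolding nbhd_in_def by blast
    then have "\<forall>\<^sub>F n in sequentially. F n \<in> V" using lim unfolding limitin_def by blast
    then obtain n where "F n \<in> V" by (auto simp: eventually_sequentially)
    then show "\<exists>f\<in>U. rational_off_diffeo E f" using V(3) F by blast
  qed (use F lim in blast)
qed

end
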